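(* Let $C_2>0$ be an upper Riesz bound of the univariate wavelet basis with respect to the $H^1$-seminorm, i.e. a constant such that for all $k$ and all real coefficients $(c_\lambda)$ $$\Big|\sum_{|\lambda|\le k} c_\lambda\psi_\lambda\Big|_1^2\le C_2^2\sum_{|\lambda|\le k}2^{2|\lambda|}c_\lambda^2 ,$$ where $\lambda$ runs over the univariate indices of level at most $k$. Let $\gamma\in(0,1)$ and $$A=2\,C_2^2\sum_{i=1}^d\sum_{j=1}^dP_{i,j}.$$ Then there exists a constant $C$ independent of $k$ such that, whenever the time step $\tau>0$ satisfies $$\tau<\frac{\gamma}{A\,4^k},$$ the matrix $\mathbf A^k$ (which depends on $k$ and $\tau$) of the sparse tensor product wavelet Crank--Nicolson--Galerkin scheme satisfies $\operatorname{cond}\mathbf A^k\le C$.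
   Context: Univariate basis. $\{\psi_\lambda:\lambda\in\mathcal J\}$ is a family of functions on $I=(0,1)$ indexed by $\lambda=(j,k)$ with level $|\lambda|=j$, satisfying: A1) it is an orthonormal basis of $L^2(I)$; A2) $\operatorname{diam}\operatorname{supp}\psi_\lambda\le C2^{-|\lambda|}$ with $C$ independent of $\lambda$, and at each level only finitely many (uniformly) supports overlap at any point; A3) the functions are continuous piecewise polynomials of order $p\ge2$; A4) the family is $\Phi_{j_0}\cup\bigcup_{j\ge j_0}\Psi_j$ with scaling functions $\Phi_{j_0}=\{\phi_{j_0,k}\}$ (assigned level $j_0$) and wavelets $\Psi_j=\{\psi_{j,k}:k\in\mathcal J_j\}$ (level $j$), each wavelet being of the form $\psi_{j,k}=2^{j/2}\psi_l(2^j\cdot-m)$ for one of finitely many generators $\psi_l$, with integers $l,m$ depending on $k$; A5) the inner wavelets have $L\ge1$ vanishing moments (an exception is allowed for boundary wavelets); A6) $\{\psi_\lambda/\|\psi_\lambda\|_1\}$ is a Riesz basis of $H_0^1(I)$. Here $\|\cdot\|_1$ and $|\cdot|_1$ are the $H^1$-norm and $H^1$-seminorm. Tensor product basis. On $\Omega=(0,1)^d$ put $\psi_\lambda(x)=\prod_{i=1}^d\psi_{\lambda_i}(x_i)$ for $\lambda=(\lambda_1,\dots,\lambda_d)$, and $\Psi^k=\{\psi_\lambda:\sum_{i=1}^d|\lambda_i|\le k\}$ (sparse tensor product set). Bilinear form. $a(u,v)=\sum_{i,j=1}^dP_{i,j}\big\langle\frac{\partial u}{\partial x_i},\frac{\partial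 v}{\partial x_j}\big\rangle+r\langle u,v\rangle$ on $H_0^1(\Omega)$, with $\langle\cdot,\cdot\rangle$ the $L^2(\Omega)$ inner product, $r\ge0$ the interest rate, $P_{i,j}=\dfrac{\rho_{i,j}\sigma_i\sigma_j}{2d_id_j}$, $d_i>0$ the side lengths of the original log-price domain, $\sigma_i>0$ volatilities, and $(\rho_{i,j}\sigma_i\sigma_j)_{i,j}$ the symmetric positive definite covariance matrix. Matrix. $\mathbf A^k$ is the symmetric matrix with entries $$\mathbf A^k_{\mu,\lambda}=\frac1\tau\langle\psi_\lambda,\psi_\mu\rangle+\frac12a(\psi_\lambda,\psi_\mu),\qquad\psi_\lambda,\psi_\mu\in\Psi^k,$$ and $\operatorname{cond}$ is the spectral condition number. *)

theory Defs
  imports "HOL-Analysis.Analysis"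
begin

section \<open>Real Lebesgue and Sobolev spaces on an open set\<close>

definition L2 :: "'a::euclidean_space set \<Rightarrow> ('a \<Rightarrow> real) set" where
  "L2 S = {f \<in> borel_measurable (lebesgue_on S). integrable (lebesgue_on S) (\<lambda>x. (f x)\<^sup>2)}"

definition L2_inner :: "'a::euclidean_space set \<Rightarrow> ('a \<Rightarrow> real) \<Rightarrow> ('a \<Rightarrow> real) \<Rightarrow> real" where
  "L2_inner S f g = (LINT x|lebesgue_on S. f x * g x)"

definition L2_nrm :: "'a::euclidean_space set \<Rightarrow> ('a \<Rightarrow> real) \<Rightarrow> real" where
  "L2_nrm S f = sqrt (L2_inner S f f)"

definition partial :: "'a::euclidean_space \<Rightarrow> ('a \<Rightarrow> real) \<Rightarrow> 'a \<Rightarrow> real" where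
  "partial b f = (\<lambda>x. frechet_derivative f (at x) b)"

text \<open>Infinitely differentiable functions: coinductively, \<open>f\<close> is smooth iff it is differentiable
  everywhere and all its first partial derivatives are again smooth.\<close>

coinductive smooth :: "('a::euclidean_space \<Rightarrow> real) \<Rightarrow> bool" where
  "(\<forall>x. f differentiable (at x)) \<Longrightarrow> (\<forall>b\<in>Basis. smooth (partial b f)) \<Longrightarrow> smooth f"

definition test_functions :: "'a::euclidean_space set \<Rightarrow> ('a \<Rightarrow> real) set" where
  "test_functions S =
     {\<phi>. smooth \<phi> \<and> compact (closure {x. \<phi> x \<noteq> 0}) \<and> closure {x. \<phi> x \<noteq> 0} \<subseteq> S}"

definition has_weak_partial ::
  "'a::euclidean_space set \<Rightarrow> 'a \<Rightarrow> ('a \<Rightarrow> real) \<Rightarrow> ('a \<Rightarrow> real) \<Rightarrow> bool" where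
  "has_weak_partial S b u g \<longleftrightarrow> u \<in> L2 S \<and> g \<in> L2 S \<and>
     (\<forall>\<phi>\<in>test_functions S. L2_inner S u (partial b \<phi>) = - L2_inner S g \<phi>)"

text \<open>Weak derivatives are unique only almost everywhere; \<open>weak_partial\<close> picks a representative,
  and is used only inside integrals. It is unspecified if no square integrable weak derivative
  exists.\<close>

definition weak_partial ::
  "'a::euclidean_space set \<Rightarrow> 'a \<Rightarrow> ('a \<Rightarrow> real) \<Rightarrow> 'a \<Rightarrow> real" where
  "weak_partial S b u = (SOME g. has_weak_partial S b u g)"

definition H1 :: "'a::euclidean_space set \<Rightarrow> ('a \<Rightarrow> real) set" where
  "H1 S = {u \<in> L2 S. \<forall>b\<in>Basis. \<exists>g. has_weak_partial S b u g}"

definition H1_seminorm :: "'a::euclidean_space set \<Rightarrow> ('a \<Rightarrow> real) \<Rightarrow> real" where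
  "H1_seminorm S u =
     sqrt (\<Sum>b\<in>Basis. L2_inner S (weak_partial S b u) (weak_partial S b u))"

definition H1_norm :: "'a::euclidean_space set \<Rightarrow> ('a \<Rightarrow> real) \<Rightarrow> real" where
  "H1_norm S u = sqrt ((L2_nrm S u)\<^sup>2 + (H1_seminorm S u)\<^sup>2)"

definition H10 :: "'a::euclidean_space set \<Rightarrow> ('a \<Rightarrow> real) set" where
  "H10 S = {u \<in> H1 S. \<forall>\<epsilon>>0. \<exists>\<phi>\<in>test_functions S. H1_norm S (\<lambda>x. u x - \<phi> x) < \<epsilon>}"


section \<open>Bases\<close>

definition lincomb :: "'l set \<Rightarrow> ('l \<Rightarrow> real) \<Rightarrow> ('l \<Rightarrow> 'a \<Rightarrow> real) \<Rightarrow> 'a \<Rightarrow> real" where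
  "lincomb F c v = (\<lambda>x. \<Sum>l\<in>F. c l * v l x)"

text \<open>A family \<open>v\<close> is dense in a function space \<open>V\<close> with norm \<open>N\<close> if every element of \<open>V\<close> is
  approximated by finite linear combinations.\<close>

definition span_dense ::
  "('a \<Rightarrow> real) set \<Rightarrow> (('a \<Rightarrow> real) \<Rightarrow> real) \<Rightarrow> 'l set \<Rightarrow> ('l \<Rightarrow> 'a \<Rightarrow> real) \<Rightarrow> bool" where
  "span_dense V N J v \<longleftrightarrow>
     (\<forall>u\<in>V. \<forall>\<epsilon>>0. \<exists>F c. finite F \<and> F \<subseteq> J \<and> N (\<lambda>x. u x - lincomb F c v x) < \<epsilon>)"

definition L2_orthonormal_basis ::
  "'a::euclidean_space set \<Rightarrow> 'l set \<Rightarrow> ('l \<Rightarrow> 'a \<Rightarrow> real) \<Rightarrow> bool" where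
  "L2_orthonormal_basis S J v \<longleftrightarrow>
     (\<forall>l\<in>J. v l \<in> L2 S) \<and>
     (\<forall>l\<in>J. \<forall>m\<in>J. L2_inner S (v l) (v m) = (if l = m then 1 else 0)) \<and>
     span_dense (L2 S) (L2_nrm S) J v"

definition riesz_basis ::
  "('a \<Rightarrow> real) set \<Rightarrow> (('a \<Rightarrow> real) \<Rightarrow> real) \<Rightarrow> 'l set \<Rightarrow> ('l \<Rightarrow> 'a \<Rightarrow> real) \<Rightarrow> bool" where
  "riesz_basis V N J v \<longleftrightarrow>
     (\<forall>l\<in>J. v l \<in> V) \<and> span_dense V N J v \<and>
     (\<exists>c1>0. \<exists>c2>0. \<forall>F c. finite F \<and> F \<subseteq> J \<longrightarrow>
        c1 * (\<Sum>l\<in>F. (c l)\<^sup>2) \<le> (N (lincomb F c v))\<^sup>2 \<and>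
        (N (lincomb F c v))\<^sup>2 \<le> c2 * (\<Sum>l\<in>F. (c l)\<^sup>2))"


section \<open>Univariate wavelet bases on the unit interval\<close>

abbreviation unit_ivl :: "real set" where
  "unit_ivl \<equiv> {0<..<1}"

text \<open>\<open>Scaling k\<close> is the index of \<open>\<phi>\<^bsub>j0,k\<^esub>\<close>, and \<open>Wavelet j k\<close> is the index of \<open>\<psi>\<^bsub>j,k\<^esub>\<close>.
  The constructors keep the scaling functions apart from the wavelets of level \<open>j0\<close>.\<close>

datatype 'k windex = Scaling 'k | Wavelet nat 'k

fun level :: "nat \<Rightarrow> 'k windex \<Rightarrow> nat" where
  "level j0 (Scaling k) = j0"
| "level j0 (Wavelet j k) = j"

definition windices :: "nat \<Rightarrow> 'k set \<Rightarrow> (nat \<Rightarrow> 'k set) \<Rightarrow> 'k windex set" where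
  "windices j0 K0 K = Scaling ` K0 \<union> {Wavelet j k |j k. j0 \<le> j \<and> k \<in> K j}"

definition supp :: "(real \<Rightarrow> real) \<Rightarrow> real set" where
  "supp f = closure {x \<in> unit_ivl. f x \<noteq> 0}"

text \<open>Piecewise polynomial of order \<open>p\<close>, i.e. of degree less than \<open>p\<close> on every interval
  that avoids a finite set of breakpoints.\<close>

definition piecewise_polynomial :: "nat \<Rightarrow> (real \<Rightarrow> real) \<Rightarrow> bool" where
  "piecewise_polynomial p f \<longleftrightarrow> (\<exists>B. finite B \<and>
     (\<forall>a b. a < b \<and> {a<..<b} \<subseteq> unit_ivl - B \<longrightarrow>
        (\<exists>c::nat \<Rightarrow> real. \<forall>x\<in>{a<..<b}. f x = (\<Sum>i<p. c i * x ^ i))))"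

text \<open>Functions on the unit interval are represented by functions on the reals; their values outside
  the interval are never inspected. The inner wavelets are those whose support
  does not touch the boundary of the interval. The index sets of the individual levels are finite,
  so that the spaces spanned up to a given level are finite-dimensional.\<close>

locale wavelet_basis =
  fixes j0 p L :: nat
    and K0 :: "'k set"
    and K :: "nat \<Rightarrow> 'k set"
    and \<psi> :: "'k windex \<Rightarrow> real \<Rightarrow> real"
  assumes finite_scaling: "finite K0"
    and finite_level: "\<forall>j\<ge>j0. finite (K j)"
    and orthonormal: "L2_orthonormal_basis unit_ivl (windices j0 K0 K) \<psi>"
    and support_diameter:
      "\<exists>C. \<forall>l\<in>windices j0 K0 K. diameter (supp (\<psi> l)) \<le> C * 2 powr (- real (level j0 l))"
    and finite_overlap:
      "\<exists>M::nat. \<forall>j. \<forall>x\<in>unit_ivl.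
         finite {l \<in> windices j0 K0 K. level j0 l = j \<and> x \<in> supp (\<psi> l)} \<and>
         card {l \<in> windices j0 K0 K. level j0 l = j \<and> x \<in> supp (\<psi> l)} \<le> M"
    and order: "p \<ge> 2"
    and continuous: "\<forall>l\<in>windices j0 K0 K. continuous_on unit_ivl (\<psi> l)"
    and piecewise: "\<forall>l\<in>windices j0 K0 K. piecewise_polynomial p (\<psi> l)"
    and generators:
      "\<exists>n. \<exists>gen::nat \<Rightarrow> real \<Rightarrow> real. \<forall>j\<ge>j0. \<forall>k\<in>K j. \<exists>i<n. \<exists>m::int. \<forall>x\<in>unit_ivl.
         \<psi> (Wavelet j k) x = 2 powr (real j / 2) * gen i (2 ^ j * x - of_int m)"
    and moments_pos: "L \<ge> 1"
    and vanishing_moments: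
      "\<forall>j\<ge>j0. \<forall>k\<in>K j. supp (\<psi> (Wavelet j k)) \<subseteq> unit_ivl \<longrightarrow>
         (\<forall>q<L. L2_inner unit_ivl (\<lambda>x. x ^ q) (\<psi> (Wavelet j k)) = 0)"
    and riesz:
      "riesz_basis (H10 unit_ivl) (H1_norm unit_ivl) (windices j0 K0 K)
         (\<lambda>l x. \<psi> l x / H1_norm unit_ivl (\<psi> l))"


section \<open>Sparse tensor product basis\<close>

definition unit_cube :: "(real ^ 'd::finite) set" where
  "unit_cube = {x. \<forall>i. 0 < x $ i \<and> x $ i < 1}"

definition tensor ::
  "('k windex \<Rightarrow> real \<Rightarrow> real) \<Rightarrow> ('d::finite \<Rightarrow> 'k windex) \<Rightarrow> real ^ 'd \<Rightarrow> real" where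
  "tensor \<psi> l = (\<lambda>x. \<Prod>i\<in>UNIV. \<psi> (l i) (x $ i))"

definition sparse_indices ::
  "nat \<Rightarrow> 'k set \<Rightarrow> (nat \<Rightarrow> 'k set) \<Rightarrow> nat \<Rightarrow> ('d::finite \<Rightarrow> 'k windex) set" where
  "sparse_indices j0 K0 K k =
     {l. (\<forall>i. l i \<in> windices j0 K0 K) \<and> (\<Sum>i\<in>UNIV. level j0 (l i)) \<le> k}"


section \<open>Bilinear form and Crank--Nicolson matrix\<close>

text \<open>\<open>\<rho>\<close>: correlations, \<open>\<sigma>\<close>: volatilities, \<open>len\<close>: side lengths of the log-price domain.\<close>

definition covariance :: "real ^ 'd ^ 'd \<Rightarrow> real ^ 'd \<Rightarrow> real ^ 'd ^ 'd::finite" where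
  "covariance \<rho> \<sigma> = (\<chi> i j. \<rho> $ i $ j * \<sigma> $ i * \<sigma> $ j)"

definition sym_pos_def :: "real ^ 'd ^ 'd::finite \<Rightarrow> bool" where
  "sym_pos_def M \<longleftrightarrow> transpose M = M \<and> (\<forall>x. x \<noteq> 0 \<longrightarrow> 0 < x \<bullet> (M *v x))"

definition diffusion :: "real ^ 'd ^ 'd \<Rightarrow> real ^ 'd \<Rightarrow> real ^ 'd \<Rightarrow> real ^ 'd ^ 'd::finite" where
  "diffusion \<rho> \<sigma> len = (\<chi> i j. \<rho> $ i $ j * \<sigma> $ i * \<sigma> $ j / (2 * len $ i * len $ j))"

definition bilinear_form ::
  "real ^ 'd ^ 'd \<Rightarrow> real \<Rightarrow> (real ^ 'd \<Rightarrow> real) \<Rightarrow> (real ^ 'd::finite \<Rightarrow> real) \<Rightarrow> real" where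
  "bilinear_form P r u v =
     (\<Sum>i\<in>UNIV. \<Sum>j\<in>UNIV. P $ i $ j *
        L2_inner unit_cube (weak_partial unit_cube (axis i 1) u)
                           (weak_partial unit_cube (axis j 1) v))
     + r * L2_inner unit_cube u v"

definition crank_nicolson_matrix ::
  "real ^ 'd ^ 'd \<Rightarrow> real \<Rightarrow> real \<Rightarrow> ('k windex \<Rightarrow> real \<Rightarrow> real) \<Rightarrow>
   ('d::finite \<Rightarrow> 'k windex) \<Rightarrow> ('d \<Rightarrow> 'k windex) \<Rightarrow> real" where
  "crank_nicolson_matrix P r \<tau> \<psi> m l =
     1 / \<tau> * L2_inner unit_cube (tensor \<psi> l) (tensor \<psi> m)
     + 1 / 2 * bilinear_form P r (tensor \<psi> l) (tensor \<psi> m)"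


section \<open>Spectral condition number\<close>

text \<open>Square matrices with rows and columns indexed by a finite set \<open>S\<close>. The spectral norm is the
  operator norm induced by the Euclidean norm. The condition number of a singular matrix is infinite
  (and that of the empty matrix is \<open>0\<close>).\<close>

definition spectral_norm :: "'i set \<Rightarrow> ('i \<Rightarrow> 'i \<Rightarrow> real) \<Rightarrow> real" where
  "spectral_norm S M =
     (SUP x\<in>{x. (\<Sum>i\<in>S. (x i)\<^sup>2) \<le> 1}. sqrt (\<Sum>i\<in>S. (\<Sum>j\<in>S. M i j * x j)\<^sup>2))"

definition inverse_matrices :: "'i set \<Rightarrow> ('i \<Rightarrow> 'i \<Rightarrow> real) \<Rightarrow> ('i \<Rightarrow> 'i \<Rightarrow> real) \<Rightarrow> bool" where
  "inverse_matrices S M N \<longleftrightarrow> (\<forall>i\<in>S. \<forall>j\<in>S.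
     (\<Sum>l\<in>S. M i l * N l j) = (if i = j then 1 else 0) \<and>
     (\<Sum>l\<in>S. N i l * M l j) = (if i = j then 1 else 0))"

definition spectral_cond :: "'i set \<Rightarrow> ('i \<Rightarrow> 'i \<Rightarrow> real) \<Rightarrow> ereal" where
  "spectral_cond S M =
     (if \<exists>N. inverse_matrices S M N
      then ereal (spectral_norm S M * spectral_norm S (SOME N. inverse_matrices S M N))
      else \<infinity>)"

end

theory Submission
  imports Defs
begin

text \<open>
  The tensor product basis is orthonormal and the form \<open>a\<close> is positive semidefinite, so \<open>1 / \<tau>\<close> is a
  lower bound for the quadratic form of the matrix. The Gram matrix of the partial derivatives in
  direction \<open>i\<close> splits into blocks which are submatrices of the univariate one, since the remaining
  factors are orthonormal; the Riesz bound therefore gives \<open>C2\<^sup>2 * 4 ^ k\<close> as an upper bound, and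
  \<open>1 / \<tau> + r / 2 + Q * C2\<^sup>2 * 4 ^ k / 2\<close> with \<open>Q = \<Sum> \<bar>P $ i $ j\<bar>\<close> bounds the norm of the matrix. The
  quotient of the two bounds is bounded because \<open>\<tau> * 4 ^ k < \<gamma> / A\<close>.

  As \<open>weak_partial\<close> is an arbitrary weak derivative, this needs that weak derivatives are unique
  almost everywhere and, by Fubini's theorem, that differentiating a tensor product weakly amounts to
  differentiating one factor.
\<close>

text \<open>Two choice operators shape the proof. \<open>spectral_cond\<close> is finite only if an
  inverse exists, on an arbitrary finite index set, so solvability is derived directly from
  positivity of the quadratic form. \<open>weak_partial\<close> is determined only up to null sets,
  by testing against coinductively \<open>smooth\<close> functions; hence the explicit exp(-1/t)
  cutoffs, which belong to a family closed under differentiation. Since \<open>\<psi> l\<close> is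
  arbitrary outside the interval and elements of \<open>L2\<close> are merely Lebesgue measurable,
  tensor products are formed from Borel representatives extended by zero. The block structure is
  available only if both derivatives have the same direction. Mixed terms are bounded through the
  pure ones in absolute value, and entries of P may be negative; this is why Q sums absolute values.
  The signed sum enters through A alone, which is positive because that sum is a value of a positive
  definite form. The factor 4^k bounds the squared weight 2^(2 level) of a single component of a
  sparse index.\<close>

section \<open>Coercive matrices\<close>

text \<open>Induction on the index set: the new row and column are eliminated by means of the Schur
  complement, which is the value of the quadratic form at \<open>w\<close> and hence positive.\<close>

lemma exists_solution:
  fixes M :: "'i \<Rightarrow> 'i \<Rightarrow> real"
  assumes "finite S"
    and "\<And>x. \<exists>i\<in>S. x i \<noteq> 0 \<Longrightarrow> 0 < (\<Sum>i\<in>S. \<Sum>j\<in>S. x i * M i j * x j)"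
  shows "\<exists>x. \<forall>i\<in>S. (\<Sum>j\<in>S. M i j * x j) = b i"
  using assms
proof (induction S arbitrary: b rule: finite_induct)
  case empty
  then show ?case by simp
next
  case (insert s T)
  have nz: "s \<noteq> j" if "j \<in> T" for j using that insert by auto
  have pos: "0 < (\<Sum>i\<in>T. \<Sum>j\<in>T. x i * M i j * x j)" if "\<exists>i\<in>T. x i \<noteq> 0" for x
  proof -
    let ?y = "x(s := 0)"
    have "0 < (\<Sum>i\<in>insert s T. \<Sum>j\<in>insert s T. ?y i * M i j * ?y j)"
      by (rule insert.prems) (use that insert.hyps in auto)
    also have "\<dots> = (\<Sum>i\<in>T. \<Sum>j\<in>T. ?y i * M i j * ?y j)"
      using insert.hyps by simp
    also have "\<dots> = (\<Sum>i\<in>T. \<Sum>j\<in>T. x i * M i j * x j)"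
      by (intro sum.cong refl) (use nz in auto)
    finally show ?thesis .
  qed
  obtain y where y: "\<And>i. i \<in> T \<Longrightarrow> (\<Sum>j\<in>T. M i j * y j) = b i"
    using insert.IH[OF pos, of b] by blast
  \<comment> \<open>Extended by 1 at s, this z becomes a vector w that all rows in T annihilate.
    Adding t * w to y therefore changes row s only, and t is chosen to remove the residual there;
    the divisor e is row s applied to w.\<close>
  obtain z where z: "\<And>i. i \<in> T \<Longrightarrow> (\<Sum>j\<in>T. M i j * z j) = - M i s"
    using insert.IH[OF pos, of "\<lambda>i. - M i s"] by blast
  define w where "w = z(s := 1)"
  define e where "e = (\<Sum>j\<in>T. M s j * z j) + M s s"
  have wT: "(\<Sum>j\<in>T. f j * w j) = (\<Sum>j\<in>T. f j * z j)" for f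
    by (intro sum.cong refl) (use nz in \<open>auto simp: w_def\<close>)
  have row: "(\<Sum>j\<in>insert s T. M i j * w j) = (if i = s then e else 0)" if "i \<in> insert s T" for i
    using that insert.hyps z nz by (auto simp: wT e_def) (auto simp: w_def)
  have "0 < (\<Sum>i\<in>insert s T. \<Sum>j\<in>insert s T. w i * M i j * w j)"
    by (rule insert.prems) (auto simp: w_def)
  also have "\<dots> = (\<Sum>i\<in>insert s T. w i * (\<Sum>j\<in>insert s T. M i j * w j))"
    by (simp only: sum_distrib_left mult.assoc)
  also have "\<dots> = (\<Sum>i\<in>insert s T. w i * (if i = s then e else 0))"
    by (intro sum.cong refl) (simp add: row)
  also have "\<dots> = (\<Sum>i\<in>insert s T. if i = s then w i * e else 0)"
    by (intro sum.cong) auto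
  also have "\<dots> = e" using insert.hyps by (simp add: w_def)
  finally have e: "e > 0" .
  define t where "t = (b s - (\<Sum>j\<in>T. M s j * y j)) / e"
  define x where "x = (\<lambda>j. if j = s then t else y j + t * z j)"
  have xT: "(\<Sum>j\<in>T. M i j * x j) = (\<Sum>j\<in>T. M i j * y j) + t * (\<Sum>j\<in>T. M i j * z j)" for i
    unfolding sum_distrib_left sum.distrib[symmetric]
    by (intro sum.cong refl) (use nz in \<open>auto simp: x_def algebra_simps\<close>)
  have "(\<Sum>j\<in>insert s T. M i j * x j) = b i" if "i \<in> insert s T" for i
  proof (cases "i = s")
    case True
    have "(\<Sum>j\<in>insert s T. M s j * x j) = (\<Sum>j\<in>T. M s j * y j) + t * e"
      using insert.hyps xT[of s] by (simp add: x_def e_def algebra_simps)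
    then show ?thesis using True e by (simp add: t_def)
  next
    case False
    then have "i \<in> T" using that by simp
    then show ?thesis
      using insert.hyps by (simp add: xT y z) (simp add: x_def)
  qed
  then show ?case by blast
qed

text \<open>Solving for the unit vectors gives a right inverse N. It is a left inverse as well: each
  column z of N M - I satisfies M z = 0, so the quadratic form vanishes at z, which positivity
  forbids unless z = 0. Symmetry of M is not assumed.\<close>

lemma coercive_imp_inverse:
  fixes M :: "'i \<Rightarrow> 'i \<Rightarrow> real"
  assumes fin: "finite S"
    and pos: "\<And>x. \<exists>i\<in>S. x i \<noteq> 0 \<Longrightarrow> 0 < (\<Sum>i\<in>S. \<Sum>j\<in>S. x i * M i j * x j)"
  shows "\<exists>N. inverse_matrices S M N"
proof -
  have "\<forall>k. \<exists>x. \<forall>i\<in>S. (\<Sum>j\<in>S. M i j * x j) = (if i = k then 1 else 0)"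
    by (rule allI, rule exists_solution[OF fin]) (erule pos)
  then obtain X where X: "\<And>k i. i \<in> S \<Longrightarrow> (\<Sum>j\<in>S. M i j * X k j) = (if i = k then 1 else 0)"
    by metis
  have "(\<Sum>l\<in>S. X l i * M l j) = (if i = j then 1 else 0)" if "i \<in> S" "j \<in> S" for i j
  proof -
    define z where "z i = (\<Sum>l\<in>S. X l i * M l j) - (if i = j then 1 else 0)" for i
    have "(\<Sum>i\<in>S. M k i * z i) = 0" if "k \<in> S" for k
    proof -
      have "(\<Sum>i\<in>S. M k i * (\<Sum>l\<in>S. X l i * M l j)) = (\<Sum>l\<in>S. (\<Sum>i\<in>S. M k i * X l i) * M l j)"
        unfolding sum_distrib_left sum_distrib_right
        by (subst sum.swap) (simp add: mult.assoc)
      also have "\<dots> = (\<Sum>l\<in>S. if k = l then M l j else 0)"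
        by (intro sum.cong refl) (simp add: X[OF that])
      also have "\<dots> = M k j" using fin that by simp
      finally have "(\<Sum>i\<in>S. M k i * (\<Sum>l\<in>S. X l i * M l j)) = M k j" .
      moreover have "(\<Sum>i\<in>S. M k i * (if i = j then 1 else 0)) = (\<Sum>i\<in>S. if i = j then M k i else 0)"
        by (intro sum.cong refl) simp
      ultimately show ?thesis
        using fin \<open>j \<in> S\<close> by (simp only: z_def right_diff_distrib sum_subtractf) simp
    qed
    then have "(\<Sum>i\<in>S. z i * (\<Sum>k\<in>S. M i k * z k)) = 0" by simp
    then have "(\<Sum>i\<in>S. \<Sum>k\<in>S. z i * M i k * z k) = 0"
      by (simp only: sum_distrib_left mult.assoc)
    then have "\<not> (\<exists>i\<in>S. z i \<noteq> 0)"
      by (intro notI) (drule pos, simp)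
    then have "z i = 0" using \<open>i \<in> S\<close> by blast
    then show ?thesis by (simp add: z_def)
  qed
  then have "inverse_matrices S M (\<lambda>i j. X j i)"
    unfolding inverse_matrices_def by (intro ballI conjI) (simp_all only: X)
  then show ?thesis by blast
qed

text \<open>A real \<open>SUP\<close> is informative only for sets bounded above. So even
  nonnegativity, witnessed by the zero vector, relies on the hypothesis about b.\<close>

lemma spectral_norm_bounds:
  assumes "\<And>x. (\<Sum>i\<in>S. (x i)\<^sup>2) \<le> 1 \<Longrightarrow> sqrt (\<Sum>i\<in>S. (\<Sum>j\<in>S. M i j * x j)\<^sup>2) \<le> b"
  shows "0 \<le> spectral_norm S M" and "spectral_norm S M \<le> b"
proof -
  let ?B = "{x. (\<Sum>i\<in>S. (x i)\<^sup>2) \<le> (1::real)}"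
  have zero: "(\<lambda>_. 0) \<in> ?B" by simp
  show "spectral_norm S M \<le> b"
    unfolding spectral_norm_def
  proof (rule cSUP_least)
    show "?B \<noteq> {}" using zero by (metis empty_iff)
    show "sqrt (\<Sum>i\<in>S. (\<Sum>j\<in>S. M i j * x j)\<^sup>2) \<le> b" if "x \<in> ?B" for x
      by (rule assms) (use that in simp)
  qed
  have "bdd_above ((\<lambda>x. sqrt (\<Sum>i\<in>S. (\<Sum>j\<in>S. M i j * x j)\<^sup>2)) ` ?B)"
    by (rule bdd_aboveI2[of _ _ b]) (simp add: assms)
  from cSUP_upper2[OF this zero, of 0] show "0 \<le> spectral_norm S M"
    unfolding spectral_norm_def by simp
qed

text \<open>The bilinear bound tested with y = M x / |M x| gives |M x| \<le> \<beta>. For the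
  inverse, put x = N y: coercivity and Cauchy-Schwarz give \<alpha> |x|^2 \<le> x . y \<le> |x| |y|,
  hence |N y| \<le> |y| / \<alpha>.\<close>

lemma spectral_cond_le:
  fixes M :: "'i \<Rightarrow> 'i \<Rightarrow> real"
  assumes fin: "finite S" and "0 < \<alpha>" "0 \<le> \<beta>"
    and lower: "\<And>x. \<alpha> * (\<Sum>i\<in>S. (x i)\<^sup>2) \<le> (\<Sum>i\<in>S. \<Sum>j\<in>S. x i * M i j * x j)"
    and upper: "\<And>x y. (\<Sum>i\<in>S. (x i)\<^sup>2) \<le> 1 \<Longrightarrow> (\<Sum>i\<in>S. (y i)\<^sup>2) \<le> 1 \<Longrightarrow>
      (\<Sum>i\<in>S. \<Sum>j\<in>S. y i * M i j * x j) \<le> \<beta>"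
  shows "spectral_cond S M \<le> ereal (\<beta> / \<alpha>)"
proof -
  have "\<exists>N. inverse_matrices S M N"
  proof (rule coercive_imp_inverse[OF fin])
    fix x :: "'i \<Rightarrow> real" assume "\<exists>i\<in>S. x i \<noteq> 0"
    then obtain i where i: "i \<in> S" "x i \<noteq> 0" by blast
    have "0 < (\<Sum>i\<in>S. (x i)\<^sup>2)"
      by (rule sum_pos2[OF fin i(1)]) (use i in auto)
    then have "0 < \<alpha> * (\<Sum>i\<in>S. (x i)\<^sup>2)" using \<open>0 < \<alpha>\<close> by simp
    then show "0 < (\<Sum>i\<in>S. \<Sum>j\<in>S. x i * M i j * x j)" using lower[of x] by linarith
  qed
  \<comment> \<open>This is the very term that occurs in \<open>spectral_cond\<close>; only its
    being an inverse is used below.\<close>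
  moreover define N where "N = (SOME N. inverse_matrices S M N)"
  ultimately have N: "inverse_matrices S M N" using someI_ex[of "inverse_matrices S M"] by simp
  have M_bound: "spectral_norm S M \<le> \<beta>"
  proof (rule spectral_norm_bounds)
    fix x :: "'i \<Rightarrow> real" assume x: "(\<Sum>i\<in>S. (x i)\<^sup>2) \<le> 1"
    define y where "y i = (\<Sum>j\<in>S. M i j * x j)" for i
    define n where "n = sqrt (\<Sum>i\<in>S. (y i)\<^sup>2)"
    have n2: "n\<^sup>2 = (\<Sum>i\<in>S. (y i)\<^sup>2)" by (simp add: n_def sum_nonneg)
    have "n \<le> \<beta>"
    proof (cases "n = 0")
      case False
      have "n \<ge> 0" by (simp add: n_def sum_nonneg)
      then have "n > 0" using False by simp
      have "(\<Sum>i\<in>S. (y i / n)\<^sup>2) = 1"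
        using False by (simp add: power_divide flip: sum_divide_distrib n2)
      then have "(\<Sum>i\<in>S. \<Sum>j\<in>S. (y i / n) * M i j * x j) \<le> \<beta>"
        by (intro upper[OF x]) simp
      moreover have "(\<Sum>i\<in>S. \<Sum>j\<in>S. (y i / n) * M i j * x j) = (\<Sum>i\<in>S. (y i)\<^sup>2) / n"
      proof -
        have "(\<Sum>j\<in>S. (y i / n) * M i j * x j) = (y i / n) * y i" for i
          unfolding y_def[of i] by (simp only: sum_distrib_left mult.assoc)
        then show ?thesis by (simp add: sum_divide_distrib power2_eq_square)
      qed
      moreover have "\<dots> = n"
        unfolding n2[symmetric] using False by (simp add: power2_eq_square)
      ultimately show ?thesis by simp
    qed (use \<open>0 \<le> \<beta>\<close> in simp)
    then show "sqrt (\<Sum>i\<in>S. (\<Sum>j\<in>S. M i j * x j)\<^sup>2) \<le> \<beta>" by (simp add: n_def y_def)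
  qed
  have N_bound: "sqrt (\<Sum>i\<in>S. (\<Sum>j\<in>S. N i j * y j)\<^sup>2) \<le> 1 / \<alpha>"
    if y: "(\<Sum>i\<in>S. (y i)\<^sup>2) \<le> 1" for y
  proof -
    define x where "x i = (\<Sum>j\<in>S. N i j * y j)" for i
    define n where "n = sqrt (\<Sum>i\<in>S. (x i)\<^sup>2)"
    have n0: "n \<ge> 0" by (simp add: n_def sum_nonneg)
    have n2: "n\<^sup>2 = (\<Sum>i\<in>S. (x i)\<^sup>2)" by (simp add: n_def sum_nonneg)
    have Mx: "(\<Sum>j\<in>S. M i j * x j) = y i" if "i \<in> S" for i
    proof -
      have "(\<Sum>j\<in>S. M i j * x j) = (\<Sum>l\<in>S. (\<Sum>j\<in>S. M i j * N j l) * y l)"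
        unfolding x_def sum_distrib_left sum_distrib_right
        by (subst sum.swap) (simp add: mult.assoc)
      also have "\<dots> = (\<Sum>l\<in>S. if i = l then y l else 0)"
        using N that by (intro sum.cong refl) (simp add: inverse_matrices_def)
      also have "\<dots> = y i" using fin that by simp
      finally show ?thesis .
    qed
    have "\<alpha> * n\<^sup>2 \<le> (\<Sum>i\<in>S. x i * y i)"
      using lower[of x] Mx by (simp add: n2 mult.assoc flip: sum_distrib_left)
    also have "\<dots> \<le> (\<Sum>i\<in>S. \<bar>x i\<bar> * \<bar>y i\<bar>)"
      unfolding abs_mult[symmetric] by (rule sum_mono) (rule abs_ge_self)
    also have "\<dots> \<le> L2_set x S * L2_set y S"
      by (rule L2_set_mult_ineq)
    also have "\<dots> \<le> n * 1"
      using y n0 by (intro mult_mono) (auto simp: L2_set_def n_def sum_nonneg)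
    finally have "\<alpha> * n\<^sup>2 \<le> n" by simp
    then have "n \<le> 1 / \<alpha>"
      using n0 \<open>0 < \<alpha>\<close> by (cases "n = 0") (auto simp: power2_eq_square field_simps)
    then show ?thesis by (simp add: n_def x_def)
  qed
  have "spectral_norm S M * spectral_norm S N \<le> \<beta> * (1 / \<alpha>)"
    using spectral_norm_bounds[OF N_bound] M_bound \<open>0 \<le> \<beta>\<close> by (intro mult_mono) auto
  then show ?thesis
    unfolding spectral_cond_def N_def[symmetric] using N by auto
qed

section \<open>Square integrable functions\<close>

lemma L2_measurable: "f \<in> L2 S \<Longrightarrow> f \<in> borel_measurable (lebesgue_on S)"
  by (simp add: L2_def)

lemma L2_mult_integrable:
  assumes "f \<in> L2 S" "g \<in> L2 S"
  shows "integrable (lebesgue_on S) (\<lambda>x. f x * g x)"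
proof (rule Bochner_Integration.integrable_bound)
  show "integrable (lebesgue_on S) (\<lambda>x. (f x)\<^sup>2 + (g x)\<^sup>2)"
    using assms by (simp add: L2_def)
  show "(\<lambda>x. f x * g x) \<in> borel_measurable (lebesgue_on S)"
    using assms by (intro borel_measurable_times L2_measurable)
  have "\<bar>a * b\<bar> \<le> a\<^sup>2 + b\<^sup>2" for a b :: real
    using sum_squares_bound[of "\<bar>a\<bar>" "\<bar>b\<bar>"] mult_nonneg_nonneg[of "\<bar>a\<bar>" "\<bar>b\<bar>"]
    unfolding abs_mult power2_abs by linarith
  then show "AE x in lebesgue_on S. norm (f x * g x) \<le> norm ((f x)\<^sup>2 + (g x)\<^sup>2)"
    by simp
qed

lemma L2_zero: "(\<lambda>_. 0) \<in> L2 S"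
  by (simp add: L2_def)

lemma L2_cmult: "f \<in> L2 S \<Longrightarrow> (\<lambda>x. c * f x) \<in> L2 S"
  by (simp add: L2_def power_mult_distrib borel_measurable_times[OF borel_measurable_const])

lemma L2_add: "f \<in> L2 S \<Longrightarrow> g \<in> L2 S \<Longrightarrow> (\<lambda>x. f x + g x) \<in> L2 S"
  using L2_mult_integrable[of f S g]
  by (simp add: L2_def power2_sum mult.assoc borel_measurable_add)

lemma L2_diff: "f \<in> L2 S \<Longrightarrow> g \<in> L2 S \<Longrightarrow> (\<lambda>x. f x - g x) \<in> L2 S"
  using L2_add[of f S "\<lambda>x. (-1) * g x"] L2_cmult[of g S "-1"] by simp

lemma L2_lincomb:
  assumes "\<And>l. l \<in> F \<Longrightarrow> v l \<in> L2 S"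
  shows "lincomb F c v \<in> L2 S"
proof (cases "finite F")
  case True
  then show ?thesis using assms
  proof (induction F)
    case empty
    show ?case by (simp add: lincomb_def L2_zero)
  next
    case (insert l F)
    have "(\<lambda>x. c l * v l x + lincomb F c v x) \<in> L2 S"
      by (rule L2_add[OF L2_cmult]) (simp_all add: insert)
    then show ?case using insert.hyps by (simp add: lincomb_def)
  qed
qed (simp add: lincomb_def L2_zero)

lemma L2_inner_commute: "L2_inner S f g = L2_inner S g f"
  by (simp add: L2_inner_def mult.commute)

lemma L2_inner_lincomb_left:
  assumes "\<And>l. l \<in> F \<Longrightarrow> v l \<in> L2 S" "g \<in> L2 S"
  shows "L2_inner S (lincomb F c v) g = (\<Sum>l\<in>F. c l * L2_inner S (v l) g)"
  using assms
  by (simp add: L2_inner_def lincomb_def sum_distrib_right mult.assoc L2_mult_integrable)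

lemma L2_inner_lincomb:
  assumes "\<And>l. l \<in> F \<Longrightarrow> v l \<in> L2 S" "\<And>m. m \<in> G \<Longrightarrow> w m \<in> L2 S"
  shows "L2_inner S (lincomb F c v) (lincomb G d w)
    = (\<Sum>l\<in>F. \<Sum>m\<in>G. c l * d m * L2_inner S (v l) (w m))"
proof -
  have "L2_inner S (v l) (lincomb G d w) = (\<Sum>m\<in>G. d m * L2_inner S (v l) (w m))" if "l \<in> F" for l
    using L2_inner_lincomb_left[of G w S "v l" d] assms that by (simp add: L2_inner_commute)
  then show ?thesis
    using assms by (simp add: L2_inner_lincomb_left L2_lincomb sum_distrib_left mult.assoc)
qed

lemma L2_inner_diff_left:
  assumes "f \<in> L2 S" "g \<in> L2 S" "h \<in> L2 S"
  shows "L2_inner S (\<lambda>x. f x - g x) h = L2_inner S f h - L2_inner S g h"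
  using assms by (simp add: L2_inner_def left_diff_distrib L2_mult_integrable)

lemma L2_inner_cong_AE:
  assumes "AE x in lebesgue_on S. f x = f' x" "AE x in lebesgue_on S. g x = g' x"
    and "f \<in> L2 S" "f' \<in> L2 S" "g \<in> L2 S" "g' \<in> L2 S"
  shows "L2_inner S f g = L2_inner S f' g'"
  unfolding L2_inner_def
proof (rule integral_cong_AE)
  show "AE x in lebesgue_on S. f x * g x = f' x * g' x"
    using assms(1,2) by eventually_elim simp
  show "(\<lambda>x. f x * g x) \<in> borel_measurable (lebesgue_on S)"
    by (rule borel_measurable_times[OF L2_measurable L2_measurable]) (rule assms)+
  show "(\<lambda>x. f' x * g' x) \<in> borel_measurable (lebesgue_on S)"
    by (rule borel_measurable_times[OF L2_measurable L2_measurable]) (rule assms)+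
qed

lemma L2_inner_self_nonneg: "0 \<le> L2_inner S f f"
  by (simp add: L2_inner_def)

text \<open>A common bound b for both squared norms lets \<bar>f g\<bar> \<le> (f^2 + g^2) / 2 take
  the place of Cauchy-Schwarz.\<close>

lemma L2_inner_abs_le:
  assumes "f \<in> L2 S" "g \<in> L2 S" "L2_inner S f f \<le> b" "L2_inner S g g \<le> b"
  shows "\<bar>L2_inner S f g\<bar> \<le> b"
proof -
  have ineq: "\<bar>a * b\<bar> \<le> (a * a + b * b) / 2" for a b :: real
    using sum_squares_bound[of "\<bar>a\<bar>" "\<bar>b\<bar>"] by (simp add: abs_mult power2_eq_square)
  note int = L2_mult_integrable[OF assms(1,1)] L2_mult_integrable[OF assms(2,2)]
  have "\<bar>L2_inner S f g\<bar> \<le> (LINT x|lebesgue_on S. \<bar>f x * g x\<bar>)"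
    unfolding L2_inner_def by (rule integral_abs_bound)
  also have "\<dots> \<le> (LINT x|lebesgue_on S. (f x * f x + g x * g x) / 2)"
    by (rule integral_mono[OF integrable_abs[OF L2_mult_integrable[OF assms(1,2)]]
          integrable_divide[OF Bochner_Integration.integrable_add[OF int]] ineq])
  also have "\<dots> = (L2_inner S f f + L2_inner S g g) / 2"
    using int by (simp add: L2_inner_def)
  finally show ?thesis using assms by simp
qed

lemma L2_cong:
  assumes "\<And>x. x \<in> S \<Longrightarrow> f x = g x"
  shows "f \<in> L2 S \<longleftrightarrow> g \<in> L2 S"
proof -
  have "f \<in> borel_measurable (lebesgue_on S) \<longleftrightarrow> g \<in> borel_measurable (lebesgue_on S)"
    by (rule measurable_cong) (simp add: assms)
  moreover have "integrable (lebesgue_on S) (\<lambda>x. (f x)\<^sup>2) \<longleftrightarrow> integrable (lebesgue_on S) (\<lambda>x. (g x)\<^sup>2)"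
    by (rule Bochner_Integration.integrable_cong) (simp_all add: assms)
  ultimately show ?thesis by (simp add: L2_def)
qed

lemma L2_inner_cong:
  assumes "\<And>x. x \<in> S \<Longrightarrow> f x = f' x" "\<And>x. x \<in> S \<Longrightarrow> g x = g' x"
  shows "L2_inner S f g = L2_inner S f' g'"
  unfolding L2_inner_def by (rule Bochner_Integration.integral_cong) (simp_all add: assms)

section \<open>Smooth functions\<close>

lemma has_derivative_partialI: "(f has_derivative f') (at x) \<Longrightarrow> partial b f x = f' b"
  unfolding partial_def by (metis frechet_derivative_at)

lemma smooth_differentiable: "smooth f \<Longrightarrow> f differentiable (at x)"
  by (erule smooth.cases) simp

lemma smooth_has_derivative: "smooth f \<Longrightarrow> (f has_derivative frechet_derivative f (at x)) (at x)"
  unfolding frechet_derivative_works[symmetric] by (rule smooth_differentiable)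

lemma smooth_partial: "smooth f \<Longrightarrow> b \<in> Basis \<Longrightarrow> smooth (partial b f)"
  by (erule smooth.cases) simp

lemma smooth_continuous: "smooth f \<Longrightarrow> continuous_on S f"
  by (intro continuous_at_imp_continuous_on ballI differentiable_imp_continuous_within
      smooth_differentiable)

lemma partial_add:
  assumes "f differentiable (at x)" "g differentiable (at x)"
  shows "partial b (\<lambda>x. f x + g x) x = partial b f x + partial b g x"
  using assms unfolding partial_def frechet_derivative_works
  by (subst frechet_derivative_at[symmetric, OF has_derivative_add]) auto

lemma partial_mult:
  assumes "f differentiable (at x)" "g differentiable (at x)"
  shows "partial b (\<lambda>x. f x * g x) x = partial b f x * g x + f x * partial b g x"
  using assms unfolding partial_def frechet_derivative_works
  by (subst frechet_derivative_at[symmetric, OF has_derivative_mult]) auto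

text \<open>The derivative of a product is a sum of products, so products of smooth functions are
  not an invariant on which coinduction can run. The generated algebra is closed under partial
  derivatives and hence is one.\<close>

inductive smooth_algebra :: "('a::euclidean_space \<Rightarrow> real) \<Rightarrow> bool" where
  base: "smooth f \<Longrightarrow> smooth_algebra f"
| add: "smooth_algebra f \<Longrightarrow> smooth_algebra g \<Longrightarrow> smooth_algebra (\<lambda>x. f x + g x)"
| mult: "smooth_algebra f \<Longrightarrow> smooth_algebra g \<Longrightarrow> smooth_algebra (\<lambda>x. f x * g x)"

lemma smooth_algebra_differentiable: "smooth_algebra f \<Longrightarrow> f differentiable (at x)"
  by (induction rule: smooth_algebra.induct) (simp_all add: smooth_differentiable)

lemma smooth_algebra_partial:
  "smooth_algebra f \<Longrightarrow> b \<in> Basis \<Longrightarrow> smooth_algebra (partial b f)"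
proof (induction rule: smooth_algebra.induct)
  case (base f)
  then show ?case by (intro smooth_algebra.base smooth_partial)
next
  case (add f g)
  then have "partial b (\<lambda>x. f x + g x) = (\<lambda>x. partial b f x + partial b g x)"
    by (intro ext partial_add smooth_algebra_differentiable)
  then show ?case using add by (simp add: smooth_algebra.add)
next
  case (mult f g)
  then have "partial b (\<lambda>x. f x * g x) = (\<lambda>x. partial b f x * g x + f x * partial b g x)"
    by (intro ext partial_mult smooth_algebra_differentiable)
  then show ?case using mult by (simp add: smooth_algebra.add smooth_algebra.mult)
qed

lemma smooth_algebra_smooth: "smooth_algebra f \<Longrightarrow> smooth f"
proof (coinduction arbitrary: f)
  case smooth
  have "\<exists>g. partial b f = g \<and> smooth_algebra g" if "b \<in> Basis" for b
    by (rule exI, rule conjI, rule refl, rule smooth_algebra_partial[OF smooth that])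
  then have "\<forall>b\<in>Basis. (\<exists>g. partial b f = g \<and> smooth_algebra g) \<or> smooth (partial b f)"
    by (intro ballI disjI1)
  moreover have "\<forall>x. f differentiable (at x)"
    by (intro allI smooth_algebra_differentiable[OF smooth])
  ultimately show ?case
    by (rule_tac exI[of _ f]) (rule conjI[OF refl conjI])
qed

lemma smooth_mult: "smooth f \<Longrightarrow> smooth g \<Longrightarrow> smooth (\<lambda>x. f x * g x)"
  by (rule smooth_algebra_smooth, rule smooth_algebra.mult) (erule smooth_algebra.base)+

lemma partial_const: "partial b (\<lambda>x. c) = (\<lambda>x. 0)"
  by (rule ext, rule has_derivative_partialI) (rule has_derivative_const)

lemma smooth_const: "smooth (\<lambda>x::'a::euclidean_space. c)"
proof (coinduction arbitrary: c)
  case smooth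
  have "(\<lambda>x::'a. c) differentiable at x" for x by (rule differentiable_const)
  moreover have "\<exists>c'. partial b (\<lambda>x::'a. c) = (\<lambda>x. c')" for b
    by (rule exI, rule partial_const)
  ultimately show ?case by (intro exI[of _ "\<lambda>x. c"] conjI allI ballI disjI1 refl)
qed

lemma smooth_prod: "finite I \<Longrightarrow> (\<And>i. i \<in> I \<Longrightarrow> smooth (f i)) \<Longrightarrow> smooth (\<lambda>x. \<Prod>i\<in>I. f i x)"
proof (induction I rule: finite_induct)
  case empty
  show ?case unfolding prod.empty by (rule smooth_const)
next
  case (insert i I)
  have "smooth (f i)" by (rule insert.prems) simp
  moreover have "smooth (\<lambda>x. \<Prod>i\<in>I. f i x)" by (rule insert.IH, rule insert.prems, simp)
  ultimately have "smooth (\<lambda>x. f i x * (\<Prod>i\<in>I. f i x))" by (rule smooth_mult)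
  then show ?case unfolding prod.insert[OF insert.hyps] .
qed

lemma smooth_compose_affine:
  fixes f :: "real \<Rightarrow> real" and v :: "'a::euclidean_space"
  assumes "smooth f"
  shows "smooth (\<lambda>x. f (x \<bullet> v + d))"
proof -
  have deriv: "((\<lambda>x. c * g (x \<bullet> v + d)) has_derivative
      (\<lambda>h. c * ((h \<bullet> v) * partial 1 g (x \<bullet> v + d)))) (at x)"
    if "smooth g" for c g and x :: 'a
  proof -
    have g: "(g has_derivative frechet_derivative g (at y)) (at y)" for y
      by (rule smooth_has_derivative[OF that])
    have lin: "frechet_derivative g (at y) h = h * frechet_derivative g (at y) 1" for y h
      using linear_scale[OF has_derivative_linear[OF g], of y h 1] by simp
    have "((\<lambda>x. c * g (x \<bullet> v + d)) has_derivative
        (\<lambda>h. c * frechet_derivative g (at (x \<bullet> v + d)) (h \<bullet> v))) (at x)"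
      by (intro has_derivative_mult_right has_derivative_compose[OF _ g])
        (auto intro!: derivative_eq_intros)
    moreover have "frechet_derivative g (at (x \<bullet> v + d)) (h \<bullet> v) = (h \<bullet> v) * partial 1 g (x \<bullet> v + d)" for h
      unfolding partial_def by (rule lin)
    ultimately show ?thesis by simp
  qed
  \<comment> \<open>The chain rule produces the constant factor \<open>b \<bullet> v\<close>.
    Generalising over c absorbs it, so that the family is closed under differentiation.\<close>
  have "smooth (\<lambda>x. c * g (x \<bullet> v + d))" if "smooth g" for c g
    using that
  proof (coinduction arbitrary: c g)
    case smooth
    then have "partial b (\<lambda>x. c * g (x \<bullet> v + d)) = (\<lambda>x. (c * (b \<bullet> v)) * partial 1 g (x \<bullet> v + d))" for b
      by (intro ext) (subst has_derivative_partialI[OF deriv], auto)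
    moreover have "smooth (partial 1 g)" using smooth by (intro smooth_partial) auto
    ultimately have "\<exists>c' g'. partial b (\<lambda>x. c * g (x \<bullet> v + d)) = (\<lambda>x. c' * g' (x \<bullet> v + d)) \<and> smooth g'" for b
      by (intro exI conjI)
    then show ?case
      by (intro exI[of _ "\<lambda>x. c * g (x \<bullet> v + d)"] conjI allI ballI disjI1 refl
          differentiableI[OF deriv[OF smooth]])
  qed
  from this[OF assms, of 1] show ?thesis by simp
qed

lemma smooth_has_derivative_slice:
  fixes f :: "'a::euclidean_space \<Rightarrow> real"
  assumes "smooth f"
  shows "((\<lambda>t. f (x + t *\<^sub>R b)) has_derivative (\<lambda>h. h * partial b f (x + t *\<^sub>R b))) (at t)"
proof -
  have g: "(f has_derivative frechet_derivative f (at y)) (at y)" for y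
    by (rule smooth_has_derivative[OF assms])
  have "((\<lambda>t. f (x + t *\<^sub>R b)) has_derivative
      (\<lambda>h. frechet_derivative f (at (x + t *\<^sub>R b)) (h *\<^sub>R b))) (at t)"
    by (rule has_derivative_compose[OF _ g]) (auto intro!: derivative_eq_intros)
  then show ?thesis
    by (simp add: partial_def linear_scale[OF has_derivative_linear[OF g]])
qed

lemma partial_slice:
  "smooth f \<Longrightarrow> partial 1 (\<lambda>t. f (x + t *\<^sub>R b)) = (\<lambda>t. partial b f (x + t *\<^sub>R b))"
  by (rule ext) (subst has_derivative_partialI[OF smooth_has_derivative_slice], auto)

lemma smooth_slice:
  fixes f :: "'a::euclidean_space \<Rightarrow> real"
  assumes "smooth f" "b \<in> Basis"
  shows "smooth (\<lambda>t::real. f (x + t *\<^sub>R b))"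
  using assms(1)
proof (coinduction arbitrary: f)
  case smooth
  have "\<exists>g. partial b' (\<lambda>t. f (x + t *\<^sub>R b)) = (\<lambda>t. g (x + t *\<^sub>R b)) \<and> smooth g"
    if "b' \<in> Basis" for b' :: real
    using that partial_slice[OF smooth, of x b]
    by (intro exI[of _ "partial b f"] conjI smooth_partial smooth assms(2)) simp
  then have "\<forall>b'\<in>Basis. (\<exists>g. partial b' (\<lambda>t. f (x + t *\<^sub>R b)) = (\<lambda>t. g (x + t *\<^sub>R b)) \<and> smooth g)
      \<or> smooth (partial b' (\<lambda>t. f (x + t *\<^sub>R b)))"
    by (intro ballI disjI1)
  moreover have "\<forall>t. (\<lambda>t. f (x + t *\<^sub>R b)) differentiable (at t)"
    by (intro allI differentiableI[OF smooth_has_derivative_slice[OF smooth]])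
  ultimately show ?case
    by (rule_tac exI[of _ "\<lambda>t. f (x + t *\<^sub>R b)"]) (rule conjI[OF refl conjI])
qed

section \<open>Smooth functions that vanish on a half line\<close>

definition flat :: "real poly \<Rightarrow> real \<Rightarrow> real" where
  "flat p t = (if 0 < t then poly p (1 / t) * exp (- 1 / t) else 0)"

lemma poly_exp_tendsto_0: "((\<lambda>s::real. poly p s * exp (- s)) \<longlongrightarrow> 0) at_top"
proof -
  have "((\<lambda>s. \<Sum>i\<le>degree p. coeff p i * (s ^ i / exp s)) \<longlongrightarrow> (\<Sum>i\<le>degree p. coeff p i * 0)) at_top"
    by (intro tendsto_intros tendsto_power_div_exp_0)
  then show ?thesis
    by (simp add: poly_altdef exp_minus divide_inverse sum_distrib_right mult.assoc)
qed

text \<open>With s = 1/t, the derivative of p(s) exp(-s) with respect to t is s^2 (p(s) - p'(s))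
  exp(-s), which explains the new polynomial and makes the family suitable for coinduction. At the
  origin the right difference quotient is s p(s) exp(-s), again a polynomial times the exponential,
  and tends to 0 as s grows.\<close>

lemma flat_has_derivative:
  "(flat p has_field_derivative flat ([:0, 0, 1:] * (p - pderiv p)) t) (at t)"
proof -
  consider "t > 0" | "t < 0" | "t = 0" by linarith
  then show ?thesis
  proof cases
    case 1
    have "((\<lambda>t. poly p (1 / t) * exp (- 1 / t)) has_field_derivative
        flat ([:0, 0, 1:] * (p - pderiv p)) t) (at t)"
      using 1 by (auto intro!: derivative_eq_intros simp: flat_def power2_eq_square field_simps)
    then show ?thesis
      by (rule has_field_derivative_transform_within_open[of _ _ _ "{0<..}"])
        (use 1 in \<open>auto simp: flat_def\<close>)
  next
    case 2
    have "((\<lambda>t. 0) has_field_derivative flat ([:0, 0, 1:] * (p - pderiv p)) t) (at t)"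
      using 2 by (simp add: flat_def)
    then show ?thesis
      by (rule has_field_derivative_transform_within_open[of _ _ _ "{..<0}"])
        (use 2 in \<open>auto simp: flat_def\<close>)
  next
    case 3
    have "((\<lambda>h. flat p h / h) \<longlongrightarrow> 0) (at_right 0)"
    proof -
      have "((\<lambda>h. poly ([:0, 1:] * p) (inverse h) * exp (- inverse h)) \<longlongrightarrow> 0) (at_right 0)"
        by (rule filterlim_compose[OF poly_exp_tendsto_0 filterlim_inverse_at_top_right])
      then show ?thesis
        by (rule Lim_transform_eventually)
          (auto simp: flat_def eventually_at_right_less field_simps intro!: eventually_at_rightI[of 0 1])
    qed
    moreover have "((\<lambda>h. flat p h / h) \<longlongrightarrow> 0) (at_left 0)"
      by (rule Lim_transform_eventually[OF tendsto_const])
        (auto simp: flat_def intro!: eventually_at_leftI[of "-1" 0])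
    ultimately have "((\<lambda>h. flat p h / h) \<longlongrightarrow> 0) (at 0)"
      by (simp add: filterlim_split_at)
    then show ?thesis
      using 3 by (simp add: DERIV_def flat_def)
  qed
qed

lemma smooth_flat: "smooth (flat p)"
proof (coinduction arbitrary: p)
  case smooth
  have "partial 1 (flat p) = flat ([:0, 0, 1:] * (p - pderiv p))" for p
    by (rule ext, subst has_derivative_partialI[OF flat_has_derivative[unfolded has_field_derivative_def]])
      simp
  then have "\<exists>q. partial b (flat p) = flat q" if "b \<in> Basis" for b :: real
    using that by (intro exI[of _ "[:0, 0, 1:] * (p - pderiv p)"]) (simp only: Basis_real_def singleton_iff)
  moreover have "flat p differentiable (at x)" for x
    unfolding real_differentiable_def by (rule exI, rule flat_has_derivative)
  ultimately show ?case
    by (intro exI[of _ "flat p"] conjI allI ballI disjI1 refl)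
qed

section \<open>Uniqueness of weak derivatives\<close>

lemma test_functions_partial:
  assumes "\<phi> \<in> test_functions S" "b \<in> Basis"
  shows "partial b \<phi> \<in> test_functions S"
proof -
  let ?K = "closure {x. \<phi> x \<noteq> 0}"
  have K: "compact ?K" "?K \<subseteq> S" "smooth \<phi>"
    using assms by (auto simp: test_functions_def)
  have "partial b \<phi> x = 0" if "x \<notin> ?K" for x
  proof -
    have "(\<phi> has_derivative (\<lambda>_. 0)) (at x)"
      by (rule has_derivative_transform_within_open[OF has_derivative_const[of 0], of "- ?K"])
        (use that closure_subset[of "{x. \<phi> x \<noteq> 0}"] in auto)
    from has_derivative_partialI[OF this] show ?thesis .
  qed
  then have "{x. partial b \<phi> x \<noteq> 0} \<subseteq> ?K" by auto
  then have sub: "closure {x. partial b \<phi> x \<noteq> 0} \<subseteq> ?K"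
    by (intro closure_minimal) auto
  then have "compact (closure {x. partial b \<phi> x \<noteq> 0})"
    using compact_Int_closed[OF K(1), of "closure {x. partial b \<phi> x \<noteq> 0}"]
    by (simp add: Int_absorb1)
  then show ?thesis
    using sub K smooth_partial[OF K(3) assms(2)] by (auto simp: test_functions_def)
qed

lemma test_functions_borel: "\<phi> \<in> test_functions S \<Longrightarrow> \<phi> \<in> borel_measurable borel"
  by (intro borel_measurable_continuous_onI smooth_continuous) (auto simp: test_functions_def)

lemma lebesgue_on_borel_measurable:
  "f \<in> borel_measurable borel \<Longrightarrow> f \<in> borel_measurable (lebesgue_on S)"
  by (intro measurable_restrict_space1 measurable_completion) simp

lemma test_functions_L2:
  assumes "\<phi> \<in> test_functions S" and S: "S \<in> sets lebesgue"
  shows "\<phi> \<in> L2 S"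
proof -
  let ?K = "closure {x. \<phi> x \<noteq> 0}"
  have \<phi>: "\<phi> \<in> borel_measurable borel" using assms by (intro test_functions_borel)
  have "integrable lborel (\<lambda>x. indicator ?K x *\<^sub>R (\<phi> x)\<^sup>2)"
    using assms
    by (intro borel_integrable_compact continuous_on_power smooth_continuous)
      (auto simp: test_functions_def)
  moreover have "indicator ?K x *\<^sub>R (\<phi> x)\<^sup>2 = (\<phi> x)\<^sup>2" for x
    using closure_subset[of "{x. \<phi> x \<noteq> 0}"] by (auto simp: indicator_def)
  ultimately have "integrable lborel (\<lambda>x. (\<phi> x)\<^sup>2)" by (simp only:)
  then have "integrable lebesgue (\<lambda>x. (\<phi> x)\<^sup>2)"
    using \<phi> by (subst integrable_completion) auto
  then have "integrable (lebesgue_on S) (\<lambda>x. (\<phi> x)\<^sup>2)"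
    using S integrable_mult_indicator[OF S, of "\<lambda>x. (\<phi> x)\<^sup>2"]
    by (subst integrable_restrict_space) auto
  then show ?thesis
    using lebesgue_on_borel_measurable[OF \<phi>] by (simp add: L2_def)
qed

text \<open>Since \<open>ennreal\<close> truncates at 0, the two densities are the positive and the
  negative part of h. The measures they define agree on boxes, which generate the Borel sets and are
  stable under intersection, so they are equal, and then so are the densities almost everywhere. As
  at most one of the two parts is nonzero at a point, both vanish.\<close>

lemma AE_zero_if_box_integrals_zero:
  fixes h :: "'a::euclidean_space \<Rightarrow> real"
  assumes h: "integrable lborel h"
    and zero: "\<And>a b. (LINT x|lborel. indicator (box a b) x * h x) = 0"
  shows "AE x in lborel. h x = 0"
proof -
  have meas: "h \<in> borel_measurable lborel" using h by auto
  let ?M = "density lborel (\<lambda>x. ennreal (h x))"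
  let ?N = "density lborel (\<lambda>x. ennreal (- h x))"
  have emeasure_box: "emeasure (density lborel (\<lambda>x. ennreal (g x))) (box a b)
      = ennreal (LINT x|lborel. indicator (box a b) x * max 0 (g x))"
    if g: "integrable lborel g" for a b and g :: "'a \<Rightarrow> real"
  proof -
    have gm: "g \<in> borel_measurable lborel" using g by auto
    have int: "integrable lborel (\<lambda>x. indicator (box a b) x * max 0 (g x))"
      using integrable_mult_indicator[of "box a b" lborel "\<lambda>x. max 0 (g x)"]
        integrable_max[OF integrable_zero g] by simp
    have "emeasure (density lborel (\<lambda>x. ennreal (g x))) (box a b)
        = (\<integral>\<^sup>+ x. ennreal (g x) * indicator (box a b) x \<partial>lborel)"
      by (rule emeasure_density) (use gm in auto)
    also have "\<dots> = (\<integral>\<^sup>+ x. ennreal (indicator (box a b) x * max 0 (g x)) \<partial>lborel)"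
      by (intro nn_integral_cong) (auto simp: indicator_def max_def ennreal_neg)
    also have "\<dots> = ennreal (LINT x|lborel. indicator (box a b) x * max 0 (g x))"
      by (rule nn_integral_eq_integral[OF int]) auto
    finally show ?thesis .
  qed
  have eq: "emeasure ?M (box a b) = emeasure ?N (box a b)" for a b
  proof -
    have int: "integrable lborel (\<lambda>x. indicator (box a b) x * max 0 (g x))"
      if "integrable lborel g" for g :: "'a \<Rightarrow> real"
      using integrable_mult_indicator[of "box a b" lborel "\<lambda>x. max 0 (g x)"]
        integrable_max[OF integrable_zero that] by simp
    have "(LINT x|lborel. indicator (box a b) x * max 0 (h x))
        - (LINT x|lborel. indicator (box a b) x * max 0 (- h x))
      = (LINT x|lborel. indicator (box a b) x * max 0 (h x) - indicator (box a b) x * max 0 (- h x))"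
      using int[OF h] int[OF integrable_minus[OF h]] by simp
    also have "\<dots> = (LINT x|lborel. indicator (box a b) x * h x)"
      by (intro Bochner_Integration.integral_cong) (auto simp: max_def indicator_def)
    finally show ?thesis
      using emeasure_box[OF h] emeasure_box[OF integrable_minus[OF h]] zero by simp
  qed
  have "?M = ?N"
  proof (rule measure_eqI_generator_eq)
    let ?E = "range (\<lambda>(a, b). box a b :: 'a set)"
    let ?A = "\<lambda>n::nat. box (- (real n *\<^sub>R One)) (real n *\<^sub>R One) :: 'a set"
    show "Int_stable ?E"
      by (auto simp: Int_stable_def box_Int_box)
    show "?E \<subseteq> Pow UNIV" "sets ?M = sigma_sets UNIV ?E" "sets ?N = sigma_sets UNIV ?E"
      by (simp_all add: borel_eq_box)
    show "range ?A \<subseteq> ?E" "(\<Union>i. ?A i) = UNIV"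
      unfolding UN_box_eq_UNIV by auto
    show "emeasure ?M (?A i) \<noteq> \<infinity>" for i
      using emeasure_box[OF h] by simp
    show "emeasure ?M X = emeasure ?N X" if "X \<in> ?E" for X
      using that eq by auto
  qed
  moreover have "(\<integral>\<^sup>+ x. ennreal (h x) \<partial>lborel) \<noteq> \<infinity>"
    using integrableD(2)[OF h] by simp
  ultimately have "AE x in lborel. ennreal (h x) = ennreal (- h x)"
    using meas by (subst (asm) finite_density_unique) auto
  then show ?thesis
    by eventually_elim (metis ennreal_eq_0_iff ennreal_neg linorder_linear neg_0_le_iff_le
        neg_le_0_iff_le order_antisym)
qed

text \<open>As \<open>exp (- 1 / (n * t))\<close> tends to \<open>1\<close> for \<open>t > 0\<close>, these functions converge boundedly to the
  indicator of the box, without any mollification.\<close>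

definition box_bump :: "'a::euclidean_space \<Rightarrow> 'a \<Rightarrow> real \<Rightarrow> 'a \<Rightarrow> real" where
  "box_bump a b n x =
     (\<Prod>i\<in>Basis. flat 1 (x \<bullet> (n *\<^sub>R i) + (- n * (a \<bullet> i))) * flat 1 (x \<bullet> (- n *\<^sub>R i) + n * (b \<bullet> i)))"

lemma smooth_box_bump: "smooth (box_bump a b n)"
proof -
  have "smooth (\<lambda>x. \<Prod>i\<in>Basis. flat 1 (x \<bullet> (n *\<^sub>R i) + (- n * (a \<bullet> i))) * flat 1 (x \<bullet> (- n *\<^sub>R i) + n * (b \<bullet> i)))"
    by (rule smooth_prod[OF finite_Basis], rule smooth_mult;
        rule smooth_compose_affine[OF smooth_flat])
  then show ?thesis unfolding box_bump_def[abs_def] .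
qed

lemma flat_bounds: "0 \<le> flat 1 t" "flat 1 t \<le> 1"
  by (auto simp: flat_def)

lemma box_bump_alt:
  "box_bump a b n x = (\<Prod>i\<in>Basis. flat 1 (n * (x \<bullet> i - a \<bullet> i)) * flat 1 (n * (b \<bullet> i - x \<bullet> i)))"
  unfolding box_bump_def by (intro prod.cong refl) (simp add: algebra_simps)

lemma box_bump_outside:
  assumes "n > 0" "x \<notin> box a b"
  shows "box_bump a b n x = 0"
proof -
  obtain i where "i \<in> Basis" "x \<bullet> i \<le> a \<bullet> i \<or> b \<bullet> i \<le> x \<bullet> i"
    using assms by (auto simp: mem_box not_less)
  then have "flat 1 (n * (x \<bullet> i - a \<bullet> i)) * flat 1 (n * (b \<bullet> i - x \<bullet> i)) = 0"
    using \<open>n > 0\<close> by (auto simp: flat_def zero_less_mult_iff)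
  then show ?thesis
    unfolding box_bump_alt using \<open>i \<in> Basis\<close> by (metis (no_types, lifting) finite_Basis prod_zero)
qed

lemma box_bump_bounds: "0 \<le> box_bump a b n x" "box_bump a b n x \<le> 1"
  unfolding box_bump_alt
  by (auto intro!: prod_nonneg prod_le_1 mult_nonneg_nonneg mult_le_one flat_bounds)

lemma box_bump_le_indicator: "n > 0 \<Longrightarrow> \<bar>box_bump a b n x\<bar> \<le> indicator (box a b) x"
  using box_bump_bounds[of a b n x] box_bump_outside[of n x a b] by (auto simp: indicator_def)

lemma box_bump_tendsto: "(\<lambda>n. box_bump a b (real (Suc n)) x) \<longlonglongrightarrow> indicator (box a b) x"
proof (cases "x \<in> box a b")
  case True
  have flat_lim: "(\<lambda>n. flat 1 (real (Suc n) * t)) \<longlonglongrightarrow> 1" if "t > 0" for t :: real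
  proof -
    have "(\<lambda>n. exp (- (inverse (real (Suc n)) * (1 / t)))) \<longlonglongrightarrow> exp (- (0 * (1 / t)))"
      by (intro tendsto_intros LIMSEQ_inverse_real_of_nat)
    moreover have "flat 1 (real (Suc n) * t) = exp (- (inverse (real (Suc n)) * (1 / t)))" for n
      using that by (simp add: flat_def divide_inverse zero_less_mult_iff)
    ultimately show ?thesis by simp
  qed
  have "(\<lambda>n. box_bump a b (real (Suc n)) x) \<longlonglongrightarrow> (\<Prod>i\<in>(Basis :: 'a set). 1 * 1)"
    unfolding box_bump_alt
    by (intro tendsto_prod tendsto_mult flat_lim) (use True in \<open>auto simp: mem_box\<close>)
  then show ?thesis using True by simp
qed (simp add: box_bump_outside)

lemma box_bump_test_function:
  assumes "n > 0" "cbox a b \<subseteq> S"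
  shows "box_bump a b n \<in> test_functions S"
proof -
  let ?K = "closure {x. box_bump a b n x \<noteq> 0}"
  have "{x. box_bump a b n x \<noteq> 0} \<subseteq> cbox a b"
    using box_bump_outside[OF assms(1)] box_subset_cbox by blast
  then have sub: "?K \<subseteq> cbox a b" by (intro closure_minimal) auto
  then have "compact ?K"
    using compact_Int_closed[OF compact_cbox, of ?K a b] by (simp add: Int_absorb1)
  then show ?thesis using sub assms(2) smooth_box_bump by (auto simp: test_functions_def)
qed

lemma indicator_box_L2:
  assumes "S \<in> sets lebesgue"
  shows "indicator (box a b) \<in> L2 S"
proof -
  have "integrable lborel (\<lambda>x::'a. (indicator (box a b) x :: real)\<^sup>2)"
    by (simp add: power2_eq_square integrable_indicator_iff emeasure_bounded_finite[unfolded infinity_ennreal_def]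
        flip: indicator_inter_arith)
  then have "integrable lebesgue (\<lambda>x::'a. (indicator (box a b) x :: real)\<^sup>2)"
    by (subst integrable_completion) auto
  then have "integrable (lebesgue_on S) (\<lambda>x::'a. (indicator (box a b) x :: real)\<^sup>2)"
    using assms integrable_mult_indicator[OF assms, of "\<lambda>x. (indicator (box a b) x :: real)\<^sup>2"]
    by (subst integrable_restrict_space) auto
  then show ?thesis
    by (simp add: L2_def lebesgue_on_borel_measurable)
qed

text \<open>Dominated convergence along the bumps: they are at most 1 and vanish off the box, so the
  restriction of h to the box dominates. The closed box has to lie in S for the bumps to be test
  functions; \<open>Suc n\<close> keeps the scaling parameter positive.\<close>

lemma box_integral_zero:
  assumes S: "open S" and h: "h \<in> L2 S"
    and orth: "\<And>\<phi>. \<phi> \<in> test_functions S \<Longrightarrow> L2_inner S h \<phi> = 0"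
    and "cbox a b \<subseteq> S"
  shows "(LINT x|lebesgue_on S. indicator (box a b) x * h x) = 0"
proof -
  have S': "S \<in> sets lebesgue" using S by auto
  let ?\<phi> = "\<lambda>n. box_bump a b (real (Suc n))"
  have test: "?\<phi> n \<in> test_functions S" for n
    by (intro box_bump_test_function) (use assms in auto)
  have "(\<lambda>n. LINT x|lebesgue_on S. ?\<phi> n x * h x) \<longlonglongrightarrow> (LINT x|lebesgue_on S. indicator (box a b) x * h x)"
  proof (rule integral_dominated_convergence)
    show "(\<lambda>x. indicator (box a b) x * h x) \<in> borel_measurable (lebesgue_on S)"
      by (rule borel_measurable_integrable[OF L2_mult_integrable[OF indicator_box_L2[OF S'] h]])
    show "(\<lambda>x. ?\<phi> n x * h x) \<in> borel_measurable (lebesgue_on S)" for n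
      by (rule borel_measurable_integrable[OF L2_mult_integrable[OF test_functions_L2[OF test S'] h]])
    show "integrable (lebesgue_on S) (\<lambda>x. \<bar>indicator (box a b) x * h x\<bar>)"
      by (rule integrable_abs[OF L2_mult_integrable[OF indicator_box_L2[OF S'] h]])
    show "AE x in lebesgue_on S. (\<lambda>n. ?\<phi> n x * h x) \<longlonglongrightarrow> indicator (box a b) x * h x"
      by (intro always_eventually allI tendsto_mult box_bump_tendsto tendsto_const)
    show "AE x in lebesgue_on S. norm (?\<phi> n x * h x) \<le> \<bar>indicator (box a b) x * h x\<bar>" for n
      using box_bump_le_indicator[of "real (Suc n)" a b]
      by (intro always_eventually allI) (simp add: abs_mult mult_right_mono)
  qed
  moreover have "(LINT x|lebesgue_on S. ?\<phi> n x * h x) = 0" for n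
    using orth[OF test] by (simp add: L2_inner_def mult.commute)
  ultimately show ?thesis by (simp add: LIMSEQ_const_iff)
qed

text \<open>A square integrable h need not be integrable on S, but it is on every box. So h is cut
  off to a box whose closure lies in S and replaced by a Borel representative, to which the
  criterion for \<open>lborel\<close> applies. Countably many closed boxes exhaust S, and their
  boundaries are null sets.\<close>

lemma AE_zero_if_orthogonal_to_test_functions:
  assumes S: "open S" and h: "h \<in> L2 S"
    and orth: "\<And>\<phi>. \<phi> \<in> test_functions S \<Longrightarrow> L2_inner S h \<phi> = 0"
  shows "AE x in lebesgue_on S. h x = 0"
proof -
  have S': "S \<in> sets lebesgue" using S by auto
  have box: "AE x in lebesgue. x \<in> box c d \<longrightarrow> h x = 0" if cd: "cbox c d \<subseteq> S" for c d
  proof -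
    define h1 where "h1 x = indicator S x *\<^sub>R (indicator (box c d) x * h x)" for x
    have "integrable (lebesgue_on S) (\<lambda>x. indicator (box c d) x * h x)"
      by (rule L2_mult_integrable[OF indicator_box_L2[OF S'] h])
    then have h1: "integrable lebesgue h1"
      unfolding h1_def using S' by (subst (asm) integrable_restrict_space) auto
    obtain h' where h': "h' \<in> borel_measurable lborel" and ae: "AE x in lborel. h1 x = h' x"
      using completion_ex_borel_measurable_real[of h1 lborel] borel_measurable_integrable[OF h1] by blast
    have ae': "AE x in lebesgue. h1 x = h' x" using ae by (rule AE_completion)
    have h'l: "h' \<in> borel_measurable lebesgue" using h' by (rule measurable_completion)
    have "integrable lebesgue h'"
      using integrable_cong_AE[OF borel_measurable_integrable[OF h1] h'l ae'] h1 by simp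
    then have int: "integrable lborel h'" using h' integrable_completion by blast
    have "AE x in lborel. h' x = 0"
    proof (rule AE_zero_if_box_integrals_zero[OF int])
      fix a b :: 'a
      define a' where "a' = (\<Sum>i\<in>Basis. max (a\<bullet>i) (c\<bullet>i) *\<^sub>R i)"
      define b' where "b' = (\<Sum>i\<in>Basis. min (b\<bullet>i) (d\<bullet>i) *\<^sub>R i)"
      have ab: "box a b \<inter> box c d = box a' b'" unfolding a'_def b'_def by (rule box_Int_box)
      have "(LINT x|lborel. indicator (box a b) x * h' x) = (LINT x|lebesgue. indicator (box a b) x * h' x)"
        by (rule integral_completion[symmetric]) (use h' in auto)
      also have "\<dots> = (LINT x|lebesgue. indicator (box a b) x * h1 x)"
        using ae' borel_measurable_integrable[OF h1] h'l
        by (intro integral_cong_AE)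
          (auto intro!: borel_measurable_times borel_measurable_indicator)
      also have "\<dots> = (LINT x|lebesgue. indicator S x *\<^sub>R (indicator (box a' b') x * h x))"
        unfolding h1_def ab[symmetric]
        by (intro Bochner_Integration.integral_cong) (auto simp: indicator_def)
      also have "\<dots> = (LINT x|lebesgue_on S. indicator (box a' b') x * h x)"
        using S' by (subst integral_restrict_space) auto
      also have "\<dots> = 0"
      proof (cases "box a' b' = {}")
        case False
        \<comment> \<open>The intersection of the two boxes is again a box. If it is nonempty, its
          closure is the closed box with the same corners; if it is empty, the integrand
          vanishes.\<close>
        have "closure (box a' b') \<subseteq> cbox c d"
          by (rule closure_minimal) (use ab box_subset_cbox[of c d] in auto)
        then have "cbox a' b' \<subseteq> S" using False cd by simp
        then show ?thesis using box_integral_zero[OF S h orth] by simp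
      qed simp
      finally show "(LINT x|lborel. indicator (box a b) x * h' x) = 0" .
    qed
    then have "AE x in lebesgue. h' x = 0" by (rule AE_completion)
    then show ?thesis
      using ae'
    proof eventually_elim
      case (elim x)
      then have "h1 x = 0" by simp
      then show ?case using cd box_subset_cbox[of c d] by (auto simp: h1_def indicator_def)
    qed
  qed
  obtain D where D: "countable D" "D \<subseteq> Pow S" "\<And>X. X \<in> D \<Longrightarrow> \<exists>a b. X = cbox a b" "\<Union>D = S"
    using open_countable_Union_open_cbox[OF S] by blast
  have "AE x in lebesgue. x \<in> X \<longrightarrow> h x = 0" if XD: "X \<in> D" for X
  proof -
    obtain c d where X: "X = cbox c d" using D(3)[OF XD] by blast
    then have "cbox c d \<subseteq> S" using D(2) XD by blast
    from box[OF this] have 1: "AE x in lebesgue. x \<in> box c d \<longrightarrow> h x = 0" .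
    have "cbox c d - box c d \<in> null_sets lebesgue"
      using negligible_frontier_interval negligible_iff_null_sets by blast
    then have 2: "AE x in lebesgue. x \<notin> cbox c d - box c d" by (rule AE_not_in)
    show ?thesis using 1 2 by eventually_elim (auto simp: X)
  qed
  then have "AE x in lebesgue. \<forall>X\<in>D. x \<in> X \<longrightarrow> h x = 0"
    using D(1) by (subst AE_ball_countable) auto
  then have "AE x in lebesgue. x \<in> S \<longrightarrow> h x = 0"
    by eventually_elim (use D(4) in blast)
  then show ?thesis using S' by (subst AE_restrict_space_iff) auto
qed

section \<open>Calculus of weak derivatives\<close>

lemma has_weak_partial_L2: "has_weak_partial S b u g \<Longrightarrow> u \<in> L2 S" "has_weak_partial S b u g \<Longrightarrow> g \<in> L2 S"
  by (simp_all add: has_weak_partial_def)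

lemma has_weak_partial_unique:
  assumes S: "open S" and g: "has_weak_partial S b u g" "has_weak_partial S b u g'"
  shows "AE x in lebesgue_on S. g x = g' x"
proof -
  have "AE x in lebesgue_on S. g x - g' x = 0"
  proof (rule AE_zero_if_orthogonal_to_test_functions[OF S])
    show "(\<lambda>x. g x - g' x) \<in> L2 S"
      by (rule L2_diff[OF g[THEN has_weak_partial_L2(2)]])
    fix \<phi> assume \<phi>: "\<phi> \<in> test_functions S"
    then have "L2_inner S g \<phi> = L2_inner S g' \<phi>"
      using g by (simp add: has_weak_partial_def)
    moreover have "\<phi> \<in> L2 S" using \<phi> S by (intro test_functions_L2) auto
    ultimately show "L2_inner S (\<lambda>x. g x - g' x) \<phi> = 0"
      using g[THEN has_weak_partial_L2(2)] by (simp add: L2_inner_diff_left)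
  qed
  then show ?thesis by simp
qed

lemma weak_partial_works: "has_weak_partial S b u g \<Longrightarrow> has_weak_partial S b u (weak_partial S b u)"
  unfolding weak_partial_def by (rule someI[where P="has_weak_partial S b u"])

lemma has_weak_partial_lincomb:
  assumes S: "open S" and b: "b \<in> Basis"
    and w: "\<And>l. l \<in> F \<Longrightarrow> has_weak_partial S b (v l) (w l)"
  shows "has_weak_partial S b (lincomb F c v) (lincomb F c w)"
  unfolding has_weak_partial_def
proof (intro conjI ballI)
  show "lincomb F c v \<in> L2 S" "lincomb F c w \<in> L2 S"
    using w by (auto intro!: L2_lincomb dest: has_weak_partial_L2)
  fix \<phi> assume \<phi>: "\<phi> \<in> test_functions S"
  have "\<phi> \<in> L2 S" "partial b \<phi> \<in> L2 S"
    using \<phi> test_functions_partial[OF \<phi> b] S by (auto intro: test_functions_L2)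
  moreover have "L2_inner S (v l) (partial b \<phi>) = - L2_inner S (w l) \<phi>" if "l \<in> F" for l
    using w[OF that] \<phi> by (simp add: has_weak_partial_def)
  ultimately show "L2_inner S (lincomb F c v) (partial b \<phi>) = - L2_inner S (lincomb F c w) \<phi>"
    using w[THEN has_weak_partial_L2(1)] w[THEN has_weak_partial_L2(2)]
    by (simp add: L2_inner_lincomb_left sum_negf)
qed

lemma has_weak_partial_cong_AE:
  assumes S: "open S" and b: "b \<in> Basis" and g: "has_weak_partial S b u g"
    and ae: "AE x in lebesgue_on S. g x = g' x" and "g' \<in> L2 S"
  shows "has_weak_partial S b u g'"
  unfolding has_weak_partial_def
proof (intro conjI ballI)
  show "u \<in> L2 S" "g' \<in> L2 S" using assms has_weak_partial_L2 by auto
  fix \<phi> assume \<phi>: "\<phi> \<in> test_functions S"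
  then have "\<phi> \<in> L2 S" using S by (auto intro: test_functions_L2)
  then have "L2_inner S g \<phi> = L2_inner S g' \<phi>"
    using assms has_weak_partial_L2(2)[OF g] by (intro L2_inner_cong_AE) auto
  then show "L2_inner S u (partial b \<phi>) = - L2_inner S g' \<phi>"
    using g \<phi> by (simp add: has_weak_partial_def)
qed

lemma has_weak_partial_cong:
  assumes "\<And>x. x \<in> S \<Longrightarrow> u x = u' x"
  shows "has_weak_partial S b u g \<longleftrightarrow> has_weak_partial S b u' g"
proof -
  have "u \<in> L2 S \<longleftrightarrow> u' \<in> L2 S" by (rule L2_cong[OF assms])
  moreover have "L2_inner S u \<phi> = L2_inner S u' \<phi>" for \<phi>
    by (rule L2_inner_cong[OF assms refl])
  ultimately show ?thesis by (simp only: has_weak_partial_def)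
qed

section \<open>Tensor products of functions of one variable\<close>

lemma test_functions_slice:
  fixes x b :: "'a::euclidean_space"
  assumes \<phi>: "\<phi> \<in> test_functions S" and b: "b \<in> Basis" and T: "\<And>t. x + t *\<^sub>R b \<in> S \<Longrightarrow> t \<in> T"
  shows "(\<lambda>t. \<phi> (x + t *\<^sub>R b)) \<in> test_functions T"
proof -
  let ?K = "closure {x. \<phi> x \<noteq> 0}"
  have K: "compact ?K" "?K \<subseteq> S" "smooth \<phi>"
    using \<phi> by (auto simp: test_functions_def)
  let ?P = "(\<lambda>t. x + t *\<^sub>R b) -` ?K"
  let ?L = "closure {t. \<phi> (x + t *\<^sub>R b) \<noteq> 0}"
  have "closed ?P" by (intro continuous_closed_vimage) (auto intro!: continuous_intros)
  moreover have "{t. \<phi> (x + t *\<^sub>R b) \<noteq> 0} \<subseteq> ?P"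
    using closure_subset[of "{x. \<phi> x \<noteq> 0}"] by auto
  ultimately have sub: "?L \<subseteq> ?P" by (intro closure_minimal)
  \<comment> \<open>Preimages of compact sets need not be compact. Here the inner product with the
    unit vector b recovers the parameter t from the point on the line, which places the preimage
    inside a continuous image of the support.\<close>
  have "?P \<subseteq> (\<lambda>z. (z - x) \<bullet> b) ` ?K"
  proof
    fix t assume "t \<in> ?P"
    then have "x + t *\<^sub>R b \<in> ?K" by simp
    moreover have "t = ((x + t *\<^sub>R b) - x) \<bullet> b" using b by simp
    ultimately show "t \<in> (\<lambda>z. (z - x) \<bullet> b) ` ?K" by blast
  qed
  with sub have "?L \<subseteq> (\<lambda>z. (z - x) \<bullet> b) ` ?K" by (rule order.trans)
  moreover have "compact ((\<lambda>z. (z - x) \<bullet> b) ` ?K)"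
    by (intro compact_continuous_image K continuous_intros)
  ultimately have "compact ?L"
    using compact_Int_closed[of _ ?L] by (metis Int_absorb1 closed_closure)
  moreover have "?L \<subseteq> T" using sub K(2) T by (metis (no_types, lifting) subset_iff vimageE)
  ultimately show ?thesis
    using smooth_slice[OF K(3) b, of x] by (simp add: test_functions_def)
qed

section \<open>Lebesgue measure on vectors as a product measure\<close>

lemma prod_Basis_vec:
  fixes f :: "real ^ 'd::finite \<Rightarrow> real"
  shows "(\<Prod>b\<in>Basis. f b) = (\<Prod>i\<in>UNIV. f (axis i 1))"
proof -
  have inj: "inj (\<lambda>i::'d. axis i (1::real))"
    by (auto simp: inj_on_def axis_eq_axis)
  have basis: "Basis = range (\<lambda>i::'d. axis i (1::real))"
    by (auto simp: Basis_vec_def)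
  show ?thesis unfolding basis prod.reindex[OF inj] by (simp only: o_def)
qed

lemma measurable_vec_lambda:
  "(\<lambda>f. \<chi> i. f i) \<in> borel_measurable (Pi\<^sub>M UNIV (\<lambda>_::'d::finite. lborel :: real measure))"
proof (subst borel_measurable_euclidean_space, intro ballI)
  fix b :: "real ^ 'd" assume "b \<in> Basis"
  then obtain i where b: "b = axis i 1" by (auto simp: Basis_vec_def)
  show "(\<lambda>f. (\<chi> i. f i) \<bullet> b) \<in> borel_measurable (Pi\<^sub>M UNIV (\<lambda>_. lborel))"
    by (simp add: b inner_axis)
qed

text \<open>Lebesgue measure is characterised by its values on boxes, and these are products of side
  lengths on both sides. Indexing the product by coordinates makes the Fubini theorems for
  \<open>Pi\<^sub>M\<close> applicable.\<close>

lemma lborel_vec: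
  "(lborel :: (real ^ 'd::finite) measure) = distr (Pi\<^sub>M UNIV (\<lambda>_. lborel)) borel (\<lambda>f. \<chi> i. f i)"
proof (rule lborel_eqI)
  interpret product_sigma_finite "\<lambda>_::'d. lborel :: real measure" ..
  fix l u :: "real ^ 'd"
  assume le: "\<And>b. b \<in> Basis \<Longrightarrow> l \<bullet> b \<le> u \<bullet> b"
  have le': "l $ i \<le> u $ i" for i
    using le[of "axis i 1"] by (simp add: inner_axis)
  have "(\<lambda>f. \<chi> i. f i) -` box l u \<inter> space (Pi\<^sub>M UNIV (\<lambda>_::'d. lborel :: real measure))
      = Pi\<^sub>E UNIV (\<lambda>i. {l $ i<..<u $ i})"
    by (auto simp: space_PiM mem_box_cart PiE_UNIV_domain Pi_iff)
  then have "emeasure (distr (Pi\<^sub>M UNIV (\<lambda>_. lborel)) borel (\<lambda>f. \<chi> i. f i)) (box l u)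
      = emeasure (Pi\<^sub>M UNIV (\<lambda>_. lborel)) (Pi\<^sub>E UNIV (\<lambda>i. {l $ i<..<u $ i}))"
    by (subst emeasure_distr[OF measurable_vec_lambda]) auto
  also have "\<dots> = (\<Prod>i\<in>UNIV. ennreal (u $ i - l $ i))"
    by (subst emeasure_PiM) (auto simp: le')
  also have "\<dots> = ennreal (\<Prod>b\<in>Basis. (u - l) \<bullet> b)"
    by (simp add: prod_Basis_vec inner_axis prod_ennreal le')
  finally show "emeasure (distr (Pi\<^sub>M UNIV (\<lambda>_. lborel)) borel (\<lambda>f. \<chi> i. f i)) (box l u)
      = ennreal (\<Prod>b\<in>Basis. (u - l) \<bullet> b)" .
qed simp

lemma integral_lborel_vec:
  fixes F :: "real ^ 'd::finite \<Rightarrow> real"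
  assumes "F \<in> borel_measurable borel"
  shows "(LINT x|lborel. F x) = (LINT f|Pi\<^sub>M UNIV (\<lambda>_. lborel). F (\<chi> i. f i))"
    and "integrable lborel F \<longleftrightarrow> integrable (Pi\<^sub>M UNIV (\<lambda>_. lborel)) (\<lambda>f. F (\<chi> i. f i))"
  by (subst lborel_vec, rule integral_distr[OF measurable_vec_lambda assms],
      subst lborel_vec, rule integrable_distr_eq[OF measurable_vec_lambda assms])

definition tensor_product :: "('d::finite \<Rightarrow> real \<Rightarrow> real) \<Rightarrow> real ^ 'd \<Rightarrow> real" where
  "tensor_product f x = (\<Prod>i\<in>UNIV. f i (x $ i))"

lemma tensor_product_borel:
  assumes "\<And>i. f i \<in> borel_measurable borel"
  shows "tensor_product f \<in> borel_measurable borel"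
proof -
  have "(\<lambda>x. \<Prod>i\<in>UNIV. f i (x $ i)) \<in> borel_measurable borel"
    by (intro borel_measurable_prod measurable_compose[OF borel_measurable_nth assms])
  then show ?thesis by (simp add: tensor_product_def[abs_def])
qed

lemma tensor_product_integral:
  fixes f :: "'d::finite \<Rightarrow> real \<Rightarrow> real"
  assumes f: "\<And>i. integrable lborel (f i)"
  shows "integrable lborel (tensor_product f)"
    and "(LINT x|lborel. tensor_product f x) = (\<Prod>i\<in>UNIV. LINT t|lborel. f i t)"
proof -
  interpret product_sigma_finite "\<lambda>_::'d. lborel :: real measure" ..
  have meas: "tensor_product f \<in> borel_measurable borel"
    by (rule tensor_product_borel) (use borel_measurable_integrable[OF f] in simp)
  have eq: "tensor_product f (\<chi> i. \<omega> i) = (\<Prod>i\<in>UNIV. f i (\<omega> i))" for \<omega>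
    by (simp add: tensor_product_def)
  show "integrable lborel (tensor_product f)"
    unfolding integral_lborel_vec(2)[OF meas] eq
    by (rule product_integrable_prod) (simp_all add: f)
  show "(LINT x|lborel. tensor_product f x) = (\<Prod>i\<in>UNIV. LINT t|lborel. f i t)"
    unfolding integral_lborel_vec(1)[OF meas] eq
    by (rule product_integral_prod) (simp_all add: f)
qed

text \<open>Borel representatives of the elements of \<open>L2 S\<close>, extended by zero: these can be multiplied and
  integrated over the whole space without leaving the Borel setting, where Fubini's theorem lives.\<close>

definition L2_borel :: "'a::euclidean_space set \<Rightarrow> ('a \<Rightarrow> real) set" where
  "L2_borel S = {f \<in> borel_measurable borel. (\<forall>x. x \<notin> S \<longrightarrow> f x = 0) \<and> integrable lborel (\<lambda>x. (f x)\<^sup>2)}"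

text \<open>If one factor vanishes outside S, the integral over S is an integral over the whole
  space. The other factor may then be any Borel function, for instance a slice of a test
  function.\<close>

lemma L2_inner_eq_lborel:
  assumes S: "S \<in> sets borel" and f: "f \<in> borel_measurable borel" "\<And>x. x \<notin> S \<Longrightarrow> f x = 0"
    and g: "g \<in> borel_measurable borel"
  shows "L2_inner S f g = (LINT x|lborel. f x * g x)"
    and "integrable (lebesgue_on S) (\<lambda>x. f x * g x) \<longleftrightarrow> integrable lborel (\<lambda>x. f x * g x)"
proof -
  have S': "S \<inter> space lebesgue \<in> sets lebesgue" using S by auto
  have eq: "indicator S x *\<^sub>R (f x * g x) = f x * g x" for x
    by (cases "x \<in> S") (simp_all add: f(2))
  have meas: "(\<lambda>x. f x * g x) \<in> borel_measurable lborel"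
    using borel_measurable_times[OF f(1) g] by simp
  show "L2_inner S f g = (LINT x|lborel. f x * g x)"
    unfolding L2_inner_def integral_restrict_space[OF S'] eq by (rule integral_completion[OF meas])
  show "integrable (lebesgue_on S) (\<lambda>x. f x * g x) \<longleftrightarrow> integrable lborel (\<lambda>x. f x * g x)"
    unfolding integrable_restrict_space[OF S'] eq by (rule integrable_completion[OF meas])
qed

lemma L2_borel_iff:
  assumes "S \<in> sets borel"
  shows "f \<in> L2_borel S \<longleftrightarrow> f \<in> L2 S \<and> f \<in> borel_measurable borel \<and> (\<forall>x. x \<notin> S \<longrightarrow> f x = 0)"
proof (cases "f \<in> borel_measurable borel \<and> (\<forall>x. x \<notin> S \<longrightarrow> f x = 0)")
  case True
  then have f: "f \<in> borel_measurable borel" "\<And>x. x \<notin> S \<Longrightarrow> f x = 0" by blast+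
  have "integrable (lebesgue_on S) (\<lambda>x. (f x)\<^sup>2) \<longleftrightarrow> integrable lborel (\<lambda>x. (f x)\<^sup>2)"
    unfolding power2_eq_square by (rule L2_inner_eq_lborel(2)[OF assms f f(1)])
  then show ?thesis
    using True lebesgue_on_borel_measurable[OF f(1), of S]
    by (simp only: L2_borel_def L2_def mem_Collect_eq simp_thms conj_commute)
next
  case False
  then show ?thesis unfolding L2_borel_def by blast
qed

lemma L2_borel_mult_integrable:
  assumes "S \<in> sets borel" "f \<in> L2_borel S" "g \<in> L2_borel S"
  shows "integrable lborel (\<lambda>x. f x * g x)" "L2_inner S f g = (LINT x|lborel. f x * g x)"
proof -
  have fg: "f \<in> L2 S" "f \<in> borel_measurable borel" "\<And>x. x \<notin> S \<Longrightarrow> f x = 0"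
    "g \<in> L2 S" "g \<in> borel_measurable borel"
    using assms(2,3) by (simp_all add: L2_borel_iff[OF assms(1)])
  show "integrable lborel (\<lambda>x. f x * g x)"
    using L2_mult_integrable[OF fg(1,4)] L2_inner_eq_lborel(2)[OF assms(1) fg(2,3,5)] by simp
  show "L2_inner S f g = (LINT x|lborel. f x * g x)"
    by (rule L2_inner_eq_lborel(1)[OF assms(1) fg(2,3,5)])
qed

lemma L2_borel_ex:
  assumes S: "S \<in> sets borel" and f: "f \<in> L2 S"
  shows "\<exists>g\<in>L2_borel S. AE x in lebesgue_on S. f x = g x"
proof -
  have S': "S \<inter> space lebesgue \<in> sets lebesgue" using S by auto
  have "(\<lambda>x. indicator S x *\<^sub>R f x) \<in> borel_measurable lebesgue"
    by (rule borel_measurable_restrict_space_iff[OF S', THEN iffD1, OF L2_measurable[OF f]])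
  then obtain g where g: "g \<in> borel_measurable lborel" "AE x in lborel. indicator S x *\<^sub>R f x = g x"
    using completion_ex_borel_measurable_real by blast
  define h where "h x = indicator S x * g x" for x
  have h: "h \<in> borel_measurable borel"
    unfolding h_def using g(1) S by (intro borel_measurable_times borel_measurable_indicator) auto
  have "AE x in lebesgue. indicator S x *\<^sub>R f x = g x" using g(2) by (rule AE_completion)
  then have "AE x in lebesgue. x \<in> S \<longrightarrow> f x = h x"
    by eventually_elim (auto simp: h_def)
  then have ae: "AE x in lebesgue_on S. f x = h x"
    using AE_restrict_space_iff[OF S'] by blast
  have hl: "h \<in> borel_measurable (lebesgue_on S)" by (rule lebesgue_on_borel_measurable[OF h])
  have "integrable (lebesgue_on S) (\<lambda>x. (h x)\<^sup>2) \<longleftrightarrow> integrable (lebesgue_on S) (\<lambda>x. (f x)\<^sup>2)"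
  proof (rule integrable_cong_AE)
    show "(\<lambda>x. (h x)\<^sup>2) \<in> borel_measurable (lebesgue_on S)"
      by (rule borel_measurable_power[OF hl])
    show "(\<lambda>x. (f x)\<^sup>2) \<in> borel_measurable (lebesgue_on S)"
      by (rule borel_measurable_power[OF L2_measurable[OF f]])
    show "AE x in lebesgue_on S. (h x)\<^sup>2 = (f x)\<^sup>2" using ae by eventually_elim simp
  qed
  then have "h \<in> L2 S" using f hl by (simp add: L2_def)
  then have "h \<in> L2_borel S" using S h by (simp add: L2_borel_iff h_def)
  then show ?thesis using ae by blast
qed

lemma unit_cube_eq_box: "unit_cube = box 0 1"
  by (auto simp: unit_cube_def mem_box_cart)

lemma open_unit_cube: "open unit_cube"
  unfolding unit_cube_eq_box by (rule open_box)

lemma tensor_product_L2_borel: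
  assumes f: "\<And>i. f i \<in> L2_borel unit_ivl"
  shows "tensor_product f \<in> L2_borel unit_cube"
  unfolding L2_borel_def
proof (intro CollectI conjI allI impI)
  show "tensor_product f \<in> borel_measurable borel"
    by (rule tensor_product_borel) (use f in \<open>simp add: L2_borel_def\<close>)
  show "tensor_product f x = 0" if "x \<notin> unit_cube" for x
  proof -
    obtain i where "x $ i \<notin> unit_ivl" using \<open>x \<notin> unit_cube\<close> by (auto simp: unit_cube_def)
    then have "f i (x $ i) = 0" using f by (simp add: L2_borel_def)
    then show ?thesis unfolding tensor_product_def by (intro prod_zero) auto
  qed
  have "integrable lborel (tensor_product (\<lambda>i x. (f i x)\<^sup>2))"
    by (rule tensor_product_integral) (use f in \<open>simp add: L2_borel_def\<close>)
  then show "integrable lborel (\<lambda>x. (tensor_product f x)\<^sup>2)"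
    by (simp add: tensor_product_def[abs_def] prod_power_distrib)
qed

lemma L2_inner_tensor_product:
  assumes f: "\<And>i. f i \<in> L2_borel unit_ivl" and g: "\<And>i. g i \<in> L2_borel unit_ivl"
  shows "L2_inner unit_cube (tensor_product f) (tensor_product g)
    = (\<Prod>i\<in>UNIV. L2_inner unit_ivl (f i) (g i))"
proof -
  have "L2_inner unit_cube (tensor_product f) (tensor_product g)
      = (LINT x|lborel. tensor_product f x * tensor_product g x)"
    by (rule L2_borel_mult_integrable[OF borel_open[OF open_unit_cube]])
      (intro tensor_product_L2_borel f g)+
  also have "\<dots> = (LINT x|lborel. tensor_product (\<lambda>i t. f i t * g i t) x)"
    by (simp add: tensor_product_def prod.distrib)
  also have "\<dots> = (\<Prod>i\<in>UNIV. LINT t|lborel. f i t * g i t)"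
    by (rule tensor_product_integral) (rule L2_borel_mult_integrable[OF _ f g], simp)
  also have "\<dots> = (\<Prod>i\<in>UNIV. L2_inner unit_ivl (f i) (g i))"
    by (intro prod.cong refl L2_borel_mult_integrable(2)[OF _ f g, symmetric]) simp
  finally show ?thesis .
qed

text \<open>Fubini with variable i innermost. The base point has coordinate 0 in direction i, so t
  is the i-th coordinate itself. The inner integral is phrased as an inner product on the interval,
  ready for the definition of the univariate weak derivative.\<close>

lemma integral_tensor_product_mult:
  fixes f :: "'d::finite \<Rightarrow> real \<Rightarrow> real"
  assumes f: "\<And>j. f j \<in> L2_borel unit_ivl" and \<phi>: "\<phi> \<in> test_functions unit_cube"
  shows "L2_inner unit_cube (tensor_product f) \<phi>
    = (LINT \<omega>|Pi\<^sub>M (UNIV - {i}) (\<lambda>_. lborel). (\<Prod>j\<in>UNIV - {i}. f j (\<omega> j)) *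
        L2_inner unit_ivl (f i) (\<lambda>t. \<phi> ((\<chi> j. if j = i then 0 else \<omega> j) + t *\<^sub>R axis i 1)))"
proof -
  interpret product_sigma_finite "\<lambda>_::'d. lborel :: real measure" ..
  let ?F = "\<lambda>x. tensor_product f x * \<phi> x"
  have tp: "tensor_product f \<in> L2_borel unit_cube" by (intro tensor_product_L2_borel f)
  have \<phi>b: "\<phi> \<in> borel_measurable borel" by (rule test_functions_borel[OF \<phi>])
  have F: "?F \<in> borel_measurable borel"
    using tp \<phi>b by (intro borel_measurable_times) (simp_all add: L2_borel_def)
  have cube: "unit_cube \<in> sets (borel :: (real ^ 'd) measure)"
    by (rule borel_open[OF open_unit_cube])
  have "\<phi> \<in> L2 unit_cube" using \<phi> cube by (intro test_functions_L2) auto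
  then have "integrable (lebesgue_on unit_cube) ?F"
    using tp cube by (intro L2_mult_integrable) (simp_all add: L2_borel_iff)
  then have "integrable lborel ?F"
    using L2_inner_eq_lborel(2)[OF cube, of "tensor_product f" \<phi>] tp \<phi>b by (simp add: L2_borel_def)
  \<comment> \<open>\<open>UNIV\<close> is read as \<open>insert i (UNIV - {i})\<close>, the form in
    which a single coordinate can be split off the product measure.\<close>
  then have int: "integrable (Pi\<^sub>M (insert i (UNIV - {i})) (\<lambda>_. lborel)) (\<lambda>\<omega>. ?F (\<chi> i. \<omega> i))"
    using integral_lborel_vec(2)[OF F] by (simp add: insert_absorb)
  have "L2_inner unit_cube (tensor_product f) \<phi> = (LINT x|lborel. ?F x)"
    using L2_inner_eq_lborel(1)[OF cube, of "tensor_product f" \<phi>] tp \<phi>b by (simp add: L2_borel_def)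
  also have "\<dots> = (LINT \<omega>|Pi\<^sub>M (insert i (UNIV - {i})) (\<lambda>_. lborel). ?F (\<chi> i. \<omega> i))"
    using integral_lborel_vec(1)[OF F] by (simp add: insert_absorb)
  also have "\<dots> = (LINT \<omega>|Pi\<^sub>M (UNIV - {i}) (\<lambda>_. lborel). LINT t|lborel. ?F (\<chi> j. fun_upd \<omega> i t j))"
    by (rule product_integral_insert[OF _ _ int]) auto
  also have "\<dots> = (LINT \<omega>|Pi\<^sub>M (UNIV - {i}) (\<lambda>_. lborel). (\<Prod>j\<in>UNIV - {i}. f j (\<omega> j)) *
        L2_inner unit_ivl (f i) (\<lambda>t. \<phi> ((\<chi> j. if j = i then 0 else \<omega> j) + t *\<^sub>R axis i 1)))"
  proof (intro Bochner_Integration.integral_cong refl)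
    fix \<omega> :: "'d \<Rightarrow> real"
    let ?x = "(\<chi> j. if j = i then 0 else \<omega> j) :: real ^ 'd"
    have x: "(\<chi> j. fun_upd \<omega> i t j) = ?x + t *\<^sub>R axis i 1" for t
      by (simp add: vec_eq_iff axis_def)
    have "tensor_product f (\<chi> j. fun_upd \<omega> i t j) = f i t * (\<Prod>j\<in>UNIV - {i}. f j (\<omega> j))" for t
    proof -
      have "tensor_product f (\<chi> j. fun_upd \<omega> i t j)
          = f i t * (\<Prod>j\<in>UNIV - {i}. f j (fun_upd \<omega> i t j))"
        unfolding tensor_product_def by (subst prod.remove[of _ i]) auto
      also have "(\<Prod>j\<in>UNIV - {i}. f j (fun_upd \<omega> i t j)) = (\<Prod>j\<in>UNIV - {i}. f j (\<omega> j))"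
        by (intro prod.cong) auto
      finally show ?thesis .
    qed
    then have "(LINT t|lborel. ?F (\<chi> j. fun_upd \<omega> i t j))
        = (LINT t|lborel. (\<Prod>j\<in>UNIV - {i}. f j (\<omega> j)) * (f i t * \<phi> (?x + t *\<^sub>R axis i 1)))"
      unfolding x by (simp add: mult_ac)
    also have "\<dots> = (\<Prod>j\<in>UNIV - {i}. f j (\<omega> j)) * (LINT t|lborel. f i t * \<phi> (?x + t *\<^sub>R axis i 1))"
      by (rule integral_mult_right_zero)
    also have "(LINT t|lborel. f i t * \<phi> (?x + t *\<^sub>R axis i 1))
        = L2_inner unit_ivl (f i) (\<lambda>t. \<phi> (?x + t *\<^sub>R axis i 1))"
    proof (rule L2_inner_eq_lborel(1)[symmetric])
      have "(\<lambda>t. ?x + t *\<^sub>R axis i 1) \<in> borel_measurable borel"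
        by (intro borel_measurable_continuous_onI continuous_intros)
      then show "(\<lambda>t. \<phi> (?x + t *\<^sub>R axis i 1)) \<in> borel_measurable borel"
        by (rule measurable_compose[OF _ \<phi>b])
    qed (use f in \<open>auto simp: L2_borel_def\<close>)
    finally show "(LINT t|lborel. ?F (\<chi> j. fun_upd \<omega> i t j))
        = (\<Prod>j\<in>UNIV - {i}. f j (\<omega> j)) * L2_inner unit_ivl (f i) (\<lambda>t. \<phi> (?x + t *\<^sub>R axis i 1))" .
  qed
  finally show ?thesis .
qed

text \<open>On every line parallel to axis i, the slice of a test function is a univariate test
  function, so the weak derivative of \<open>f i\<close> can be tested against it. The other factors
  are constant along the line and agree for \<open>f\<close> and \<open>f(i := g)\<close>;
  integrating over the lines gives the claim.\<close>

lemma has_weak_partial_tensor_product: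
  fixes f :: "'d::finite \<Rightarrow> real \<Rightarrow> real"
  assumes f: "\<And>j. f j \<in> L2_borel unit_ivl" and g: "g \<in> L2_borel unit_ivl"
    and weak: "has_weak_partial unit_ivl 1 (f i) g"
  shows "has_weak_partial unit_cube (axis i 1) (tensor_product f) (tensor_product (f(i := g)))"
  unfolding has_weak_partial_def
proof (intro conjI ballI)
  have f': "(f(i := g)) j \<in> L2_borel unit_ivl" for j
    using f g by simp
  have cube: "unit_cube \<in> sets (borel :: (real ^ 'd) measure)"
    by (rule borel_open[OF open_unit_cube])
  show "tensor_product f \<in> L2 unit_cube" "tensor_product (f(i := g)) \<in> L2 unit_cube"
    using tensor_product_L2_borel[of f, OF f] tensor_product_L2_borel[of "f(i := g)", OF f']
    unfolding L2_borel_iff[OF cube] by blast+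
  fix \<phi> :: "real ^ 'd \<Rightarrow> real" assume \<phi>: "\<phi> \<in> test_functions unit_cube"
  have b: "axis i 1 \<in> (Basis :: (real ^ 'd) set)" by (simp add: axis_in_Basis_iff)
  let ?x = "\<lambda>\<omega>. (\<chi> j. if j = i then 0 else \<omega> j) :: real ^ 'd"
  have slice: "L2_inner unit_ivl (f i) (\<lambda>t. partial (axis i 1) \<phi> (?x \<omega> + t *\<^sub>R axis i 1))
      = - L2_inner unit_ivl g (\<lambda>t. \<phi> (?x \<omega> + t *\<^sub>R axis i 1))" for \<omega>
  proof -
    have "(\<lambda>t. \<phi> (?x \<omega> + t *\<^sub>R axis i 1)) \<in> test_functions unit_ivl"
    proof (rule test_functions_slice[OF \<phi> b])
      fix t assume "?x \<omega> + t *\<^sub>R axis i 1 \<in> unit_cube"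
      then have "0 < (?x \<omega> + t *\<^sub>R axis i 1) $ i \<and> (?x \<omega> + t *\<^sub>R axis i 1) $ i < 1"
        by (simp only: unit_cube_def mem_Collect_eq)
      then show "t \<in> unit_ivl" by simp
    qed
    then have "L2_inner unit_ivl (f i) (partial 1 (\<lambda>t. \<phi> (?x \<omega> + t *\<^sub>R axis i 1)))
        = - L2_inner unit_ivl g (\<lambda>t. \<phi> (?x \<omega> + t *\<^sub>R axis i 1))"
      using weak by (simp add: has_weak_partial_def)
    moreover have "smooth \<phi>" using \<phi> by (simp add: test_functions_def)
    ultimately show ?thesis by (simp add: partial_slice)
  qed
  have "(\<Prod>j\<in>UNIV - {i}. (f(i := g)) j (\<omega> j)) = (\<Prod>j\<in>UNIV - {i}. f j (\<omega> j))" for \<omega>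
    by (intro prod.cong) auto
  then show "L2_inner unit_cube (tensor_product f) (partial (axis i 1) \<phi>)
      = - L2_inner unit_cube (tensor_product (f(i := g))) \<phi>"
    using integral_tensor_product_mult[where f=f and i=i, OF f test_functions_partial[OF \<phi> b]]
      integral_tensor_product_mult[where f="f(i := g)" and i=i, OF f' \<phi>]
    by (simp only: slice fun_upd_same) simp
qed

section \<open>Sparse tensor product wavelets\<close>

text \<open>Overwriting component i by the placeholder w forgets that component, so a fibre of this
  map is parametrised by the forgotten value a.\<close>

lemma sum_filter_fibre:
  fixes h :: "('d \<Rightarrow> 'w) \<Rightarrow> real"
  assumes W: "\<And>l. l \<in> S \<Longrightarrow> l i \<in> W" and r: "r \<in> (\<lambda>l. l(i := w)) ` S"
  shows "(\<Sum>l\<in>{l \<in> S. l(i := w) = r}. h l) = (\<Sum>a\<in>{a \<in> W. r(i := a) \<in> S}. h (r(i := a)))"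
proof -
  have r': "r(i := w) = r" using r by auto
  show ?thesis
  proof (rule sum.reindex_bij_witness[where i="\<lambda>a. r(i := a)" and j="\<lambda>l. l i"])
    fix l assume "l \<in> {l \<in> S. l(i := w) = r}"
    then have l: "l \<in> S" "r = l(i := w)" by auto
    show eq: "r(i := l i) = l" unfolding l(2) by simp
    show "l i \<in> {a \<in> W. r(i := a) \<in> S}" using W[OF l(1)] l(1) eq by simp
    show "h (r(i := l i)) = h l" by (simp only: eq)
  next
    fix a assume "a \<in> {a \<in> W. r(i := a) \<in> S}"
    then show "r(i := a) \<in> {l \<in> S. l(i := w) = r}" "(r(i := a)) i = a"
      using r' by simp_all
  qed
qed

text \<open>The matrix is block diagonal, with one block for every choice of the components other than \<open>i\<close>,
  and each block is a principal submatrix of \<open>G\<close>.\<close>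

lemma tensor_quadratic_form_le:
  fixes x :: "('d \<Rightarrow> 'w) \<Rightarrow> real"
  assumes S: "finite S" and W: "finite W" "\<And>l. l \<in> S \<Longrightarrow> l i \<in> W"
    and B: "\<And>c. (\<Sum>a\<in>W. \<Sum>b\<in>W. c a * c b * G a b) \<le> B * (\<Sum>a\<in>W. (c a)\<^sup>2)"
  shows "(\<Sum>l\<in>S. \<Sum>m\<in>S. x l * x m * (if l(i := w) = m(i := w) then G (l i) (m i) else 0))
    \<le> B * (\<Sum>l\<in>S. (x l)\<^sup>2)"
proof -
  let ?key = "\<lambda>l. l(i := w)"
  let ?R = "?key ` S"
  let ?fib = "\<lambda>r. {l \<in> S. ?key l = r}"
  have group: "(\<Sum>l\<in>S. h l) = (\<Sum>r\<in>?R. \<Sum>l\<in>?fib r. h l)" for h :: "('d \<Rightarrow> 'w) \<Rightarrow> real"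
    by (rule sum.group[symmetric]) (use S in auto)
  have inner: "(\<Sum>m\<in>S. x l * x m * (if ?key l = ?key m then G (l i) (m i) else 0))
      = (\<Sum>m\<in>?fib r. x l * x m * G (l i) (m i))" if "?key l = r" for l r
  proof -
    have "(\<Sum>m\<in>S. x l * x m * (if ?key l = ?key m then G (l i) (m i) else 0))
        = (\<Sum>m\<in>S. if ?key m = r then x l * x m * G (l i) (m i) else 0)"
      by (intro sum.cong refl) (use that in auto)
    also have "\<dots> = (\<Sum>m\<in>?fib r. x l * x m * G (l i) (m i))"
      by (rule sum.inter_filter[symmetric]) (rule S)
    finally show ?thesis .
  qed
  have "(\<Sum>l\<in>S. \<Sum>m\<in>S. x l * x m * (if ?key l = ?key m then G (l i) (m i) else 0))
      = (\<Sum>r\<in>?R. \<Sum>l\<in>?fib r. \<Sum>m\<in>?fib r. x l * x m * G (l i) (m i))"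
    unfolding group[of "\<lambda>l. \<Sum>m\<in>S. x l * x m * (if ?key l = ?key m then G (l i) (m i) else 0)"]
    by (intro sum.cong refl inner) simp
  also have "\<dots> \<le> (\<Sum>r\<in>?R. B * (\<Sum>l\<in>?fib r. (x l)\<^sup>2))"
  proof (rule sum_mono)
    fix r assume r: "r \<in> ?R"
    let ?A = "{a \<in> W. r(i := a) \<in> S}"
    \<comment> \<open>Extension by zero of the coefficients on this fibre to all of W: the bound for
      the full matrix G then covers the principal submatrix that belongs to the fibre.\<close>
    define c where "c a = (if r(i := a) \<in> S then x (r(i := a)) else 0)" for a
    have restrict: "(\<Sum>a\<in>?A. x (r(i := a)) * h a) = (\<Sum>a\<in>W. c a * h a)" for h :: "'w \<Rightarrow> real"
      unfolding sum.inter_filter[OF W(1)] by (intro sum.cong refl) (simp add: c_def)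
    have fib: "(\<Sum>l\<in>?fib r. h l) = (\<Sum>a\<in>?A. h (r(i := a)))" for h :: "('d \<Rightarrow> 'w) \<Rightarrow> real"
      using W(2) r by (rule sum_filter_fibre)
    have "(\<Sum>l\<in>?fib r. \<Sum>m\<in>?fib r. x l * x m * G (l i) (m i))
        = (\<Sum>a\<in>?A. x (r(i := a)) * (\<Sum>b\<in>?A. x (r(i := b)) * G a b))"
      unfolding fib by (simp add: sum_distrib_left mult.assoc)
    also have "\<dots> = (\<Sum>a\<in>W. \<Sum>b\<in>W. c a * c b * G a b)"
      unfolding restrict by (simp add: sum_distrib_left mult.assoc)
    also have "\<dots> \<le> B * (\<Sum>a\<in>W. (c a)\<^sup>2)" by (rule B)
    also have "(\<Sum>a\<in>W. (c a)\<^sup>2) = (\<Sum>a\<in>?A. x (r(i := a)) * x (r(i := a)))"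
      unfolding sum.inter_filter[OF W(1)]
      by (intro sum.cong refl) (simp add: c_def power2_eq_square)
    also have "\<dots> = (\<Sum>l\<in>?fib r. (x l)\<^sup>2)"
      unfolding fib by (simp add: power2_eq_square)
    finally show "(\<Sum>l\<in>?fib r. \<Sum>m\<in>?fib r. x l * x m * G (l i) (m i)) \<le> B * (\<Sum>l\<in>?fib r. (x l)\<^sup>2)" .
  qed
  also have "\<dots> = B * (\<Sum>l\<in>S. (x l)\<^sup>2)"
    unfolding group[of "\<lambda>l. (x l)\<^sup>2"] by (simp only: sum_distrib_left)
  finally show ?thesis .
qed

lemma sum_swap_outer:
  "(\<Sum>m\<in>A. \<Sum>l\<in>B. \<Sum>i\<in>I. H m l i) = (\<Sum>i\<in>I. \<Sum>m\<in>A. \<Sum>l\<in>B. H m l i)"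
proof -
  have "(\<Sum>l\<in>B. \<Sum>i\<in>I. H m l i) = (\<Sum>i\<in>I. \<Sum>l\<in>B. H m l i)" for m
    by (rule sum.swap)
  then show ?thesis by (simp only: sum.swap[of _ I A])
qed

section \<open>Univariate basis functions and their derivatives\<close>

context wavelet_basis
begin

abbreviation indices :: "'k windex set" where
  "indices \<equiv> windices j0 K0 K"

abbreviation indices_le :: "nat \<Rightarrow> 'k windex set" where
  "indices_le k \<equiv> {l \<in> indices. level j0 l \<le> k}"

lemma finite_indices_le: "finite (indices_le k)"
proof (rule finite_subset)
  show "indices_le k \<subseteq> Scaling ` K0 \<union> (\<Union>j\<in>{j0..k}. Wavelet j ` K j)"
    by (auto simp: windices_def)
  show "finite (Scaling ` K0 \<union> (\<Union>j\<in>{j0..k}. Wavelet j ` K j))"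
    using finite_scaling finite_level by simp
qed

lemma sparse_index_component:
  fixes l :: "'d::finite \<Rightarrow> 'k windex"
  assumes "l \<in> sparse_indices j0 K0 K k"
  shows "l i \<in> indices_le k"
proof -
  have "level j0 (l i) \<le> (\<Sum>i\<in>UNIV. level j0 (l i))"
    by (rule member_le_sum) auto
  then show ?thesis using assms by (auto simp: sparse_indices_def)
qed

lemma finite_sparse_indices:
  "finite (sparse_indices j0 K0 K k :: ('d::finite \<Rightarrow> 'k windex) set)"
proof (rule finite_subset)
  show "sparse_indices j0 K0 K k \<subseteq> (Pi\<^sub>E UNIV (\<lambda>_. indices_le k) :: ('d \<Rightarrow> 'k windex) set)"
    using sparse_index_component by (auto simp: PiE_UNIV_domain)
  show "finite (Pi\<^sub>E UNIV (\<lambda>_. indices_le k) :: ('d \<Rightarrow> 'k windex) set)"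
    by (intro finite_PiE finite_indices_le) simp
qed

text \<open>The values of \<open>\<psi> l\<close> outside the interval are unspecified. Cutting them
  off yields an element of \<open>L2_borel\<close>, with Borel measurability coming from continuity
  on the open interval.\<close>

definition ext :: "'k windex \<Rightarrow> real \<Rightarrow> real" where
  "ext l t = indicator unit_ivl t * \<psi> l t"

lemma ext_L2_borel:
  assumes "l \<in> indices"
  shows "ext l \<in> L2_borel unit_ivl"
proof -
  have "\<psi> l \<in> L2 unit_ivl" using orthonormal assms by (simp add: L2_orthonormal_basis_def)
  then have "ext l \<in> L2 unit_ivl" by (subst L2_cong[of _ _ "\<psi> l"]) (simp_all add: ext_def)
  moreover have "(\<lambda>t. indicator unit_ivl t *\<^sub>R \<psi> l t) \<in> borel_measurable borel"
    using continuous assms by (intro borel_measurable_continuous_on_indicator) auto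
  ultimately show ?thesis by (simp add: L2_borel_iff ext_def[abs_def])
qed

lemma L2_inner_ext:
  assumes "l \<in> indices" "m \<in> indices"
  shows "L2_inner unit_ivl (ext l) (ext m) = (if l = m then 1 else 0)"
proof -
  have "L2_inner unit_ivl (ext l) (ext m) = L2_inner unit_ivl (\<psi> l) (\<psi> m)"
    by (rule L2_inner_cong) (simp_all add: ext_def)
  then show ?thesis using orthonormal assms by (simp add: L2_orthonormal_basis_def)
qed

lemma H1_norm_pos:
  assumes "l \<in> indices"
  shows "H1_norm unit_ivl (\<psi> l) > 0"
proof -
  have "L2_nrm unit_ivl (\<psi> l) = 1"
    using orthonormal assms by (simp add: L2_orthonormal_basis_def L2_nrm_def)
  then have "(L2_nrm unit_ivl (\<psi> l))\<^sup>2 + (H1_seminorm unit_ivl (\<psi> l))\<^sup>2 > 0"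
    by (simp add: add_pos_nonneg)
  then show ?thesis by (simp add: H1_norm_def)
qed

text \<open>Only the normalised functions are known to lie in \<open>H10\<close>, through the Riesz
  basis property. Multiplying by the norm, which is positive by orthonormality, gives a weak
  derivative of \<open>\<psi> l\<close> itself, and a Borel representative of it serves for the zero
  extension too.\<close>

lemma ex_dext:
  assumes "l \<in> indices"
  shows "\<exists>g. g \<in> L2_borel unit_ivl \<and> has_weak_partial unit_ivl 1 (ext l) g"
proof -
  define N where "N = H1_norm unit_ivl (\<psi> l)"
  have N: "N > 0" using H1_norm_pos[OF assms] by (simp add: N_def)
  have "(\<lambda>x. \<psi> l x / N) \<in> H1 unit_ivl"
    using riesz assms by (simp add: riesz_basis_def H10_def N_def)
  then obtain g where g: "has_weak_partial unit_ivl 1 (\<lambda>x. \<psi> l x / N) g"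
    by (auto simp: H1_def)
  have "has_weak_partial unit_ivl 1 (lincomb {l} (\<lambda>_. N) (\<lambda>_ x. \<psi> l x / N)) (lincomb {l} (\<lambda>_. N) (\<lambda>_. g))"
    by (rule has_weak_partial_lincomb) (simp_all add: g)
  moreover have "lincomb {l} (\<lambda>_. N) (\<lambda>_ x. \<psi> l x / N) = \<psi> l"
    using N by (simp add: lincomb_def)
  ultimately obtain h where h: "has_weak_partial unit_ivl 1 (\<psi> l) h" by auto
  have "\<exists>g\<in>L2_borel unit_ivl. AE x in lebesgue_on unit_ivl. h x = g x"
    by (rule L2_borel_ex) (simp_all add: has_weak_partial_L2(2)[OF h])
  then obtain d where d: "d \<in> L2_borel unit_ivl" "AE x in lebesgue_on unit_ivl. h x = d x"
    by blast
  have "d \<in> L2 unit_ivl" using d(1) by (simp add: L2_borel_iff)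
  with d(2) have "has_weak_partial unit_ivl 1 (\<psi> l) d"
    using h by (intro has_weak_partial_cong_AE[of unit_ivl 1 "\<psi> l" h d]) simp_all
  moreover have "has_weak_partial unit_ivl 1 (ext l) d \<longleftrightarrow> has_weak_partial unit_ivl 1 (\<psi> l) d"
    by (rule has_weak_partial_cong) (simp add: ext_def)
  ultimately show ?thesis using d(1) by blast
qed

definition dext :: "'k windex \<Rightarrow> real \<Rightarrow> real" where
  "dext l = (SOME g. g \<in> L2_borel unit_ivl \<and> has_weak_partial unit_ivl 1 (ext l) g)"

lemma dext:
  assumes "l \<in> indices"
  shows "dext l \<in> L2_borel unit_ivl" "has_weak_partial unit_ivl 1 (ext l) (dext l)"
  using someI_ex[OF ex_dext[OF assms]] unfolding dext_def by blast+

text \<open>This translates the assumed Riesz bound into a bound for the Gram matrix of the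
  functions \<open>dext l\<close>. The basis of the reals is {1}, so the seminorm has a single
  summand.\<close>

lemma H1_seminorm_lincomb:
  assumes F: "F \<subseteq> indices"
  shows "(H1_seminorm unit_ivl (lincomb F c \<psi>))\<^sup>2
    = (\<Sum>l\<in>F. \<Sum>m\<in>F. c l * c m * L2_inner unit_ivl (dext l) (dext m))"
proof -
  let ?u = "lincomb F c \<psi>"
  let ?d = "lincomb F c dext"
  have "has_weak_partial unit_ivl 1 (\<psi> l) (dext l)" if "l \<in> F" for l
  proof -
    have "has_weak_partial unit_ivl 1 (ext l) (dext l)" by (rule dext) (use that F in blast)
    moreover have "has_weak_partial unit_ivl 1 (ext l) (dext l)
        \<longleftrightarrow> has_weak_partial unit_ivl 1 (\<psi> l) (dext l)"
      by (rule has_weak_partial_cong) (simp add: ext_def)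
    ultimately show ?thesis by simp
  qed
  then have d: "has_weak_partial unit_ivl 1 ?u ?d"
    by (intro has_weak_partial_lincomb) simp_all
  note w = weak_partial_works[OF d]
  have ae: "AE x in lebesgue_on unit_ivl. weak_partial unit_ivl 1 ?u x = ?d x"
    by (rule has_weak_partial_unique[OF _ w d]) simp
  have "(H1_seminorm unit_ivl ?u)\<^sup>2
      = L2_inner unit_ivl (weak_partial unit_ivl 1 ?u) (weak_partial unit_ivl 1 ?u)"
    by (simp add: H1_seminorm_def L2_inner_self_nonneg)
  also have "\<dots> = L2_inner unit_ivl ?d ?d"
    by (rule L2_inner_cong_AE[OF ae ae]) (rule has_weak_partial_L2(2)[OF w] has_weak_partial_L2(2)[OF d])+
  also have "\<dots> = (\<Sum>l\<in>F. \<Sum>m\<in>F. c l * c m * L2_inner unit_ivl (dext l) (dext m))"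
  proof (rule L2_inner_lincomb)
    show "dext l \<in> L2 unit_ivl" if "l \<in> F" for l
      using dext(1)[of l] that F by (auto simp: L2_borel_iff)
    then show "dext l \<in> L2 unit_ivl" if "l \<in> F" for l using that .
  qed
  finally show ?thesis .
qed

section \<open>Gram matrices of tensor products and of their partial derivatives\<close>

definition dtensor :: "'d::finite \<Rightarrow> ('d \<Rightarrow> 'k windex) \<Rightarrow> real ^ 'd \<Rightarrow> real" where
  "dtensor i l = tensor_product ((\<lambda>j. ext (l j))(i := dext (l i)))"

lemma tensor_eq_tensor_product: "x \<in> unit_cube \<Longrightarrow> tensor \<psi> l x = tensor_product (\<lambda>j. ext (l j)) x"
  unfolding tensor_def tensor_product_def
  by (intro prod.cong refl) (simp add: ext_def unit_cube_def)

lemma dtensor_L2_borel: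
  assumes "\<And>j. l j \<in> indices"
  shows "dtensor i l \<in> L2_borel unit_cube"
  unfolding dtensor_def
  by (rule tensor_product_L2_borel) (simp add: assms ext_L2_borel dext)

lemma unit_cube_borel: "unit_cube \<in> sets borel"
  by (rule borel_open[OF open_unit_cube])

lemma dtensor_L2:
  assumes "\<And>j. l j \<in> indices"
  shows "dtensor i l \<in> L2 unit_cube"
  using dtensor_L2_borel[of l i, OF assms] by (simp add: L2_borel_iff[OF unit_cube_borel])

lemma has_weak_partial_tensor:
  assumes "\<And>j. l j \<in> indices"
  shows "has_weak_partial unit_cube (axis i 1) (tensor \<psi> l) (dtensor i l)"
proof -
  have "has_weak_partial unit_cube (axis i 1) (tensor_product (\<lambda>j. ext (l j))) (dtensor i l)"
    unfolding dtensor_def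
    by (rule has_weak_partial_tensor_product) (simp_all add: assms ext_L2_borel dext)
  moreover have "has_weak_partial unit_cube (axis i 1) (tensor \<psi> l) (dtensor i l)
      \<longleftrightarrow> has_weak_partial unit_cube (axis i 1) (tensor_product (\<lambda>j. ext (l j))) (dtensor i l)"
    by (rule has_weak_partial_cong[OF tensor_eq_tensor_product])
  ultimately show ?thesis by simp
qed

lemma L2_inner_weak_partial_tensor:
  assumes l: "\<And>j. l j \<in> indices" and m: "\<And>j. m j \<in> indices"
  shows "L2_inner unit_cube (weak_partial unit_cube (axis i 1) (tensor \<psi> l))
      (weak_partial unit_cube (axis j 1) (tensor \<psi> m))
    = L2_inner unit_cube (dtensor i l) (dtensor j m)"
proof -
  note dl = has_weak_partial_tensor[of l i, OF l] and dm = has_weak_partial_tensor[of m j, OF m]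
  note wl = weak_partial_works[OF dl] and wm = weak_partial_works[OF dm]
  show ?thesis
    by (rule L2_inner_cong_AE[OF has_weak_partial_unique[OF open_unit_cube wl dl]
        has_weak_partial_unique[OF open_unit_cube wm dm]
        has_weak_partial_L2(2)[OF wl] has_weak_partial_L2(2)[OF dl]
        has_weak_partial_L2(2)[OF wm] has_weak_partial_L2(2)[OF dm]])
qed

lemma L2_inner_tensor:
  assumes l: "\<And>j. l j \<in> indices" and m: "\<And>j. m j \<in> indices"
  shows "L2_inner unit_cube (tensor \<psi> l) (tensor \<psi> m) = (if l = m then 1 else 0)"
proof -
  have "L2_inner unit_cube (tensor \<psi> l) (tensor \<psi> m)
      = L2_inner unit_cube (tensor_product (\<lambda>j. ext (l j))) (tensor_product (\<lambda>j. ext (m j)))"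
    by (rule L2_inner_cong) (simp_all only: tensor_eq_tensor_product)
  also have "\<dots> = (\<Prod>j\<in>UNIV. L2_inner unit_ivl (ext (l j)) (ext (m j)))"
    by (rule L2_inner_tensor_product) (simp_all add: l m ext_L2_borel)
  also have "\<dots> = (\<Prod>j\<in>UNIV. if l j = m j then 1 else 0)"
    by (simp add: L2_inner_ext l m)
  also have "\<dots> = (if l = m then 1 else 0)"
  proof (cases "l = m")
    case False
    then obtain j where "l j \<noteq> m j" by auto
    then show ?thesis using False by (auto intro!: prod_zero)
  qed simp
  finally show ?thesis .
qed

text \<open>With the same direction i on both sides, all factors other than i are orthonormal and
  multiply to the Kronecker delta of the remaining components. For two different directions there is
  no such simplification.\<close>

lemma L2_inner_dtensor:
  fixes l m :: "'d::finite \<Rightarrow> 'k windex"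
  assumes l: "\<And>j. l j \<in> indices" and m: "\<And>j. m j \<in> indices"
  shows "L2_inner unit_cube (dtensor i l) (dtensor i m)
    = (if l(i := w) = m(i := w) then L2_inner unit_ivl (dext (l i)) (dext (m i)) else 0)"
proof -
  let ?f = "\<lambda>l. (\<lambda>j. ext (l j))(i := dext (l i))"
  have mem: "?f l j \<in> L2_borel unit_ivl" if "\<And>j. l j \<in> indices" for l :: "'d \<Rightarrow> 'k windex" and j
    using that by (simp add: ext_L2_borel dext)
  have "L2_inner unit_cube (dtensor i l) (dtensor i m)
      = (\<Prod>j\<in>UNIV. L2_inner unit_ivl (?f l j) (?f m j))"
    unfolding dtensor_def by (intro L2_inner_tensor_product mem l m)
  also have "\<dots> = L2_inner unit_ivl (dext (l i)) (dext (m i))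
      * (\<Prod>j\<in>UNIV - {i}. L2_inner unit_ivl (?f l j) (?f m j))"
    by (subst prod.remove[of _ i]) auto
  also have "(\<Prod>j\<in>UNIV - {i}. L2_inner unit_ivl (?f l j) (?f m j))
      = (\<Prod>j\<in>UNIV - {i}. if l j = m j then 1 else 0)"
    by (intro prod.cong refl) (simp add: L2_inner_ext l m)
  also have "\<dots> = (if l(i := w) = m(i := w) then 1 else 0)"
  proof (cases "l(i := w) = m(i := w)")
    case True
    then have "l j = m j" if "j \<noteq> i" for j using that by (metis fun_upd_other)
    then show ?thesis using True by simp
  next
    case False
    then obtain j where "j \<noteq> i" "l j \<noteq> m j" by (auto simp: fun_eq_iff split: if_splits)
    then show ?thesis using False by (auto intro!: prod_zero)
  qed
  finally show ?thesis by simp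
qed

lemma sparse_index_mem: "l \<in> sparse_indices j0 K0 K k \<Longrightarrow> l j \<in> indices"
  by (simp add: sparse_indices_def)

text \<open>Only component i carries a weight. Levels are natural numbers with sum at most k, so
  each of them is at most k and the weight is at most 4^k.\<close>

lemma dtensor_lincomb_bound:
  fixes x :: "('d::finite \<Rightarrow> 'k windex) \<Rightarrow> real"
  assumes upper: "\<And>c. (H1_seminorm unit_ivl (lincomb (indices_le k) c \<psi>))\<^sup>2
      \<le> C2\<^sup>2 * (\<Sum>l\<in>indices_le k. 2 ^ (2 * level j0 l) * (c l)\<^sup>2)"
  shows "L2_inner unit_cube (lincomb (sparse_indices j0 K0 K k) x (dtensor i))
      (lincomb (sparse_indices j0 K0 K k) x (dtensor i))
    \<le> (C2\<^sup>2 * 4 ^ k) * (\<Sum>l\<in>sparse_indices j0 K0 K k. (x l)\<^sup>2)"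
proof -
  let ?S = "sparse_indices j0 K0 K k :: ('d \<Rightarrow> 'k windex) set"
  let ?W = "indices_le k"
  define G where "G a b = L2_inner unit_ivl (dext a) (dext b)" for a b
  have "L2_inner unit_cube (lincomb ?S x (dtensor i)) (lincomb ?S x (dtensor i))
      = (\<Sum>l\<in>?S. \<Sum>m\<in>?S. x l * x m * L2_inner unit_cube (dtensor i l) (dtensor i m))"
    by (rule L2_inner_lincomb) (rule dtensor_L2, erule sparse_index_mem)+
  \<comment> \<open>\<open>undefined\<close> is the placeholder for component i; any fixed index
    would do.\<close>
  also have "\<dots> = (\<Sum>l\<in>?S. \<Sum>m\<in>?S. x l * x m *
      (if l(i := undefined) = m(i := undefined) then G (l i) (m i) else 0))"
    unfolding G_def
    by (intro sum.cong refl arg_cong2[where f="(*)"] L2_inner_dtensor) (erule sparse_index_mem)+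
  also have "\<dots> \<le> (C2\<^sup>2 * 4 ^ k) * (\<Sum>l\<in>?S. (x l)\<^sup>2)"
  proof (rule tensor_quadratic_form_le)
    show "finite ?S" by (rule finite_sparse_indices)
    show "finite ?W" by (rule finite_indices_le)
    show "l i \<in> ?W" if "l \<in> ?S" for l using that by (rule sparse_index_component)
    fix c :: "'k windex \<Rightarrow> real"
    have "(\<Sum>a\<in>?W. \<Sum>b\<in>?W. c a * c b * G a b) = (H1_seminorm unit_ivl (lincomb ?W c \<psi>))\<^sup>2"
      unfolding G_def by (rule H1_seminorm_lincomb[symmetric]) blast
    also have "\<dots> \<le> C2\<^sup>2 * (\<Sum>l\<in>?W. 2 ^ (2 * level j0 l) * (c l)\<^sup>2)" by (rule upper)
    also have "\<dots> \<le> C2\<^sup>2 * (\<Sum>l\<in>?W. 4 ^ k * (c l)\<^sup>2)"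
    proof (intro mult_left_mono sum_mono mult_right_mono)
      fix l assume "l \<in> ?W"
      then have "(4::real) ^ level j0 l \<le> 4 ^ k" by (intro power_increasing) auto
      then show "(2::real) ^ (2 * level j0 l) \<le> 4 ^ k" by (simp add: power_mult)
    qed auto
    also have "\<dots> = (C2\<^sup>2 * 4 ^ k) * (\<Sum>l\<in>?W. (c l)\<^sup>2)"
      by (simp only: sum_distrib_left mult.assoc)
    finally show "(\<Sum>a\<in>?W. \<Sum>b\<in>?W. c a * c b * G a b) \<le> (C2\<^sup>2 * 4 ^ k) * (\<Sum>l\<in>?W. (c l)\<^sup>2)" .
  qed
  finally show ?thesis .
qed

text \<open>Orthonormality reduces the mass part to the Euclidean product. The stiffness part is
  expressed by norms and products of whole linear combinations, so it can be estimated independently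
  of the number of indices. The column index l belongs to the first argument of the form, which
  pairs x with direction i and y with j.\<close>

lemma crank_nicolson_quadratic_form:
  fixes x y :: "('d::finite \<Rightarrow> 'k windex) \<Rightarrow> real" and k :: nat
  defines "S \<equiv> sparse_indices j0 K0 K k"
  shows "(\<Sum>m\<in>S. \<Sum>l\<in>S. y m * crank_nicolson_matrix P r \<tau> \<psi> m l * x l)
    = (1 / \<tau> + r / 2) * (\<Sum>l\<in>S. y l * x l)
      + 1 / 2 * (\<Sum>i\<in>UNIV. \<Sum>j\<in>UNIV. P $ i $ j *
          L2_inner unit_cube (lincomb S x (dtensor i)) (lincomb S y (dtensor j)))"
proof -
  have fin: "finite S" unfolding S_def by (rule finite_sparse_indices)
  have mem: "l j \<in> indices" if "l \<in> S" for l j using that unfolding S_def by (rule sparse_index_mem)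
  define E where "E i j l m = L2_inner unit_cube (dtensor i l) (dtensor j m)" for i j :: 'd and l m
  have entry: "crank_nicolson_matrix P r \<tau> \<psi> m l = (1 / \<tau> + r / 2) * (if l = m then 1 else 0)
      + 1 / 2 * (\<Sum>i\<in>UNIV. \<Sum>j\<in>UNIV. P $ i $ j * E i j l m)" if "l \<in> S" "m \<in> S" for l m
  proof -
    have "L2_inner unit_cube (weak_partial unit_cube (axis i 1) (tensor \<psi> l))
        (weak_partial unit_cube (axis j 1) (tensor \<psi> m)) = E i j l m" for i j
      unfolding E_def by (intro L2_inner_weak_partial_tensor mem that)
    moreover have "L2_inner unit_cube (tensor \<psi> l) (tensor \<psi> m) = (if l = m then 1 else 0)"
      by (intro L2_inner_tensor mem that)
    ultimately show ?thesis
      unfolding crank_nicolson_matrix_def bilinear_form_def by (simp add: algebra_simps)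
  qed
  have lin: "L2_inner unit_cube (lincomb S x (dtensor i)) (lincomb S y (dtensor j))
      = (\<Sum>m\<in>S. \<Sum>l\<in>S. y m * E i j l m * x l)" for i j
  proof -
    have "L2_inner unit_cube (lincomb S x (dtensor i)) (lincomb S y (dtensor j))
        = (\<Sum>l\<in>S. \<Sum>m\<in>S. x l * y m * E i j l m)"
      unfolding E_def by (rule L2_inner_lincomb) (rule dtensor_L2, erule mem)+
    also have "\<dots> = (\<Sum>m\<in>S. \<Sum>l\<in>S. x l * y m * E i j l m)" by (rule sum.swap)
    finally show ?thesis by (simp add: mult_ac)
  qed
  have "(\<Sum>m\<in>S. \<Sum>l\<in>S. y m * crank_nicolson_matrix P r \<tau> \<psi> m l * x l)
      = (\<Sum>m\<in>S. \<Sum>l\<in>S. (1 / \<tau> + r / 2) * (if l = m then y m * x l else 0)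
        + 1 / 2 * (\<Sum>i\<in>UNIV. \<Sum>j\<in>UNIV. P $ i $ j * (y m * E i j l m * x l)))"
  proof (intro sum.cong refl)
    fix m l assume "m \<in> S" "l \<in> S"
    have "y m * (\<Sum>i\<in>UNIV. \<Sum>j\<in>UNIV. P $ i $ j * E i j l m) * x l
        = (\<Sum>i\<in>UNIV. \<Sum>j\<in>UNIV. P $ i $ j * (y m * E i j l m * x l))"
      by (simp add: sum_distrib_left sum_distrib_right mult_ac)
    then show "y m * crank_nicolson_matrix P r \<tau> \<psi> m l * x l
        = (1 / \<tau> + r / 2) * (if l = m then y m * x l else 0)
          + 1 / 2 * (\<Sum>i\<in>UNIV. \<Sum>j\<in>UNIV. P $ i $ j * (y m * E i j l m * x l))"
      unfolding entry[OF \<open>l \<in> S\<close> \<open>m \<in> S\<close>] by (simp add: algebra_simps)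
  qed
  also have "\<dots> = (1 / \<tau> + r / 2) * (\<Sum>m\<in>S. \<Sum>l\<in>S. if l = m then y m * x l else 0)
      + 1 / 2 * (\<Sum>m\<in>S. \<Sum>l\<in>S. \<Sum>i\<in>UNIV. \<Sum>j\<in>UNIV. P $ i $ j * (y m * E i j l m * x l))"
    by (simp only: sum.distrib sum_distrib_left)
  also have "(\<Sum>m\<in>S. \<Sum>l\<in>S. if l = m then y m * x l else 0) = (\<Sum>m\<in>S. y m * x m)"
    using fin by (intro sum.cong refl) simp
  also have "(\<Sum>m\<in>S. \<Sum>l\<in>S. \<Sum>i\<in>UNIV. \<Sum>j\<in>UNIV. P $ i $ j * (y m * E i j l m * x l))
      = (\<Sum>i\<in>UNIV. \<Sum>j\<in>UNIV. \<Sum>m\<in>S. \<Sum>l\<in>S. P $ i $ j * (y m * E i j l m * x l))"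
    by (simp only: sum_swap_outer[where I="UNIV :: 'd set"])
  finally show ?thesis by (simp only: lin sum_distrib_left)
qed

end

section \<open>The condition number\<close>

text \<open>Semidefiniteness of P is applied at each point x to the vector of values
  \<open>u i x\<close>, and the result is integrated.\<close>

lemma quadratic_form_nonneg_L2:
  fixes P :: "real ^ 'd ^ 'd::finite"
  assumes P: "\<And>z. 0 \<le> (\<Sum>i\<in>UNIV. \<Sum>j\<in>UNIV. P $ i $ j * (z i * z j))"
    and u: "\<And>i. u i \<in> L2 S"
  shows "0 \<le> (\<Sum>i\<in>UNIV. \<Sum>j\<in>UNIV. P $ i $ j * L2_inner S (u i) (u j))"
proof -
  have int: "integrable (lebesgue_on S) (\<lambda>x. P $ i $ j * (u i x * u j x))" for i j
    using L2_mult_integrable[OF u u] by (rule integrable_mult_right)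
  have "0 \<le> (LINT x|lebesgue_on S. (\<Sum>i\<in>UNIV. \<Sum>j\<in>UNIV. P $ i $ j * (u i x * u j x)))"
    by (rule Bochner_Integration.integral_nonneg) (rule P)
  also have "\<dots> = (\<Sum>i\<in>UNIV. \<Sum>j\<in>UNIV. (LINT x|lebesgue_on S. P $ i $ j * (u i x * u j x)))"
    using int by (simp only: Bochner_Integration.integral_sum Bochner_Integration.integrable_sum)
  also have "\<dots> = (\<Sum>i\<in>UNIV. \<Sum>j\<in>UNIV. P $ i $ j * L2_inner S (u i) (u j))"
    unfolding L2_inner_def by simp
  finally show ?thesis .
qed

text \<open>P is half the congruence transform of the covariance by the diagonal matrix with entries
  1 / len, so it inherits positivity.\<close>

lemma diffusion_quadratic_form:
  fixes z :: "'d::finite \<Rightarrow> real"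
  shows "(\<Sum>i\<in>UNIV. \<Sum>j\<in>UNIV. diffusion \<rho> \<sigma> len $ i $ j * (z i * z j))
    = 1 / 2 * ((\<chi> i. z i / len $ i) \<bullet> (covariance \<rho> \<sigma> *v (\<chi> i. z i / len $ i)))"
  unfolding inner_vec_def matrix_vector_mult_def sum_distrib_left
  by (intro sum.cong refl) (simp add: diffusion_def covariance_def sum_distrib_left mult_ac)

theorem theorem18:
  fixes j0 p L :: nat
    and K0 :: "'k set"
    and K :: "nat \<Rightarrow> 'k set"
    and \<psi> :: "'k windex \<Rightarrow> real \<Rightarrow> real"
    and \<rho> :: "real ^ 'd ^ 'd::finite"
    and \<sigma> len :: "real ^ 'd"
    and P :: "real ^ 'd ^ 'd"
    and r C2 \<gamma> A :: real
  assumes "wavelet_basis j0 p L K0 K \<psi>"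
    and "0 \<le> r"
    and "\<forall>i. 0 < len $ i"
    and "\<forall>i. 0 < \<sigma> $ i"
    and "sym_pos_def (covariance \<rho> \<sigma>)"
    and "P = diffusion \<rho> \<sigma> len"
    and "0 < C2"
    and "\<forall>k c. (H1_seminorm unit_ivl
                  (lincomb {l \<in> windices j0 K0 K. level j0 l \<le> k} c \<psi>))\<^sup>2
           \<le> C2\<^sup>2 * (\<Sum>l | l \<in> windices j0 K0 K \<and> level j0 l \<le> k. 2 ^ (2 * level j0 l) * (c l)\<^sup>2)"
    and "0 < \<gamma>" and "\<gamma> < 1"
    and "A = 2 * C2\<^sup>2 * (\<Sum>i\<in>UNIV. \<Sum>j\<in>UNIV. P $ i $ j)"
  shows "\<exists>C::real. \<forall>(k::nat) (\<tau>::real). 0 < \<tau> \<longrightarrow> \<tau> < \<gamma> / (A * 4 ^ k) \<longrightarrow>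
           spectral_cond (sparse_indices j0 K0 K k) (crank_nicolson_matrix P r \<tau> \<psi>) \<le> ereal C"
proof -
  interpret wavelet_basis j0 p L K0 K \<psi> by fact
  have P_nonneg: "0 \<le> (\<Sum>i\<in>UNIV. \<Sum>j\<in>UNIV. P $ i $ j * (z i * z j))" for z
  proof -
    have "0 \<le> v \<bullet> (covariance \<rho> \<sigma> *v v)" for v
      using assms(5) by (cases "v = 0") (auto simp: sym_pos_def_def less_imp_le)
    then show ?thesis unfolding assms(6) diffusion_quadratic_form by simp
  qed
  \<comment> \<open>The sum of all entries is the quadratic form of P at the all-ones vector, that
    is, half the covariance form at the nonzero vector 1 / len.\<close>
  have "0 < (\<Sum>i\<in>UNIV. \<Sum>j\<in>UNIV. P $ i $ j)"
  proof -
    let ?v = "(\<chi> i. 1 / len $ i) :: real ^ 'd"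
    have "?v \<noteq> 0" using assms(3) by (simp add: vec_eq_iff less_imp_neq[symmetric])
    then have "0 < ?v \<bullet> (covariance \<rho> \<sigma> *v ?v)"
      using assms(5) by (simp add: sym_pos_def_def)
    then show ?thesis
      using diffusion_quadratic_form[of \<rho> \<sigma> len "\<lambda>_. 1"] by (simp add: assms(6))
  qed
  then have A: "A > 0" using assms(7,11) by simp
  define Q where "Q = (\<Sum>i\<in>UNIV. \<Sum>j\<in>UNIV. \<bar>P $ i $ j\<bar>)"
  have Q: "Q \<ge> 0" by (simp add: Q_def sum_nonneg)
  \<comment> \<open>The quotient of the bounds is 1 + \<tau> r / 2 + \<tau> 4^k Q C2^2 / 2. Both
    \<tau> and \<tau> 4^k are at most \<gamma> / A, the former because 4^k is at least 1.\<close>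
  define C where "C = 1 + \<gamma> / A * (r / 2 + 1 / 2 * (Q * C2\<^sup>2))"
  have "spectral_cond (sparse_indices j0 K0 K k :: ('d \<Rightarrow> 'k windex) set)
      (crank_nicolson_matrix P r \<tau> \<psi>) \<le> ereal C"
    if \<tau>: "0 < \<tau>" "\<tau> < \<gamma> / (A * 4 ^ k)" for k \<tau>
  proof -
    let ?S = "sparse_indices j0 K0 K k :: ('d \<Rightarrow> 'k windex) set"
    let ?M = "crank_nicolson_matrix P r \<tau> \<psi> :: ('d \<Rightarrow> 'k windex) \<Rightarrow> _"
    let ?U = "\<lambda>x i. lincomb ?S x (dtensor i)"
    define b where "b = C2\<^sup>2 * 4 ^ k"
    define \<beta> where "\<beta> = 1 / \<tau> + r / 2 + 1 / 2 * (Q * b)"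
    have b: "b \<ge> 0" by (simp add: b_def)
    have U: "?U x i \<in> L2 unit_cube" for x i
      by (rule L2_lincomb, rule dtensor_L2, erule sparse_index_mem)
    have U_bound: "L2_inner unit_cube (?U x i) (?U x i) \<le> b * (\<Sum>l\<in>?S. (x l)\<^sup>2)" for x i
      unfolding b_def by (rule dtensor_lincomb_bound) (use assms(8) in blast)
    have "spectral_cond ?S ?M \<le> ereal (\<beta> / (1 / \<tau>))"
    proof (rule spectral_cond_le)
      show "finite ?S" by (rule finite_sparse_indices)
      show "0 < 1 / \<tau>" using \<tau> by simp
      show "0 \<le> \<beta>" using \<tau> b Q assms(2) by (simp add: \<beta>_def)
    next
      fix x :: "('d \<Rightarrow> 'k windex) \<Rightarrow> real"
      have "0 \<le> (\<Sum>i\<in>UNIV. \<Sum>j\<in>UNIV. P $ i $ j * L2_inner unit_cube (?U x i) (?U x j))"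
        by (rule quadratic_form_nonneg_L2[OF P_nonneg U])
      moreover have "0 \<le> r / 2 * (\<Sum>l\<in>?S. x l * x l)"
        using assms(2) by (simp add: sum_nonneg)
      ultimately show "1 / \<tau> * (\<Sum>l\<in>?S. (x l)\<^sup>2) \<le> (\<Sum>m\<in>?S. \<Sum>l\<in>?S. x m * ?M m l * x l)"
        unfolding crank_nicolson_quadratic_form by (simp add: distrib_right power2_eq_square)
    next
      fix x y :: "('d \<Rightarrow> 'k windex) \<Rightarrow> real"
      assume x: "(\<Sum>l\<in>?S. (x l)\<^sup>2) \<le> 1" and y: "(\<Sum>l\<in>?S. (y l)\<^sup>2) \<le> 1"
      have "(\<Sum>l\<in>?S. y l * x l) \<le> (\<Sum>l\<in>?S. ((y l)\<^sup>2 + (x l)\<^sup>2) / 2)"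
        using sum_squares_bound by (intro sum_mono) (simp add: field_simps)
      also have "\<dots> = ((\<Sum>l\<in>?S. (y l)\<^sup>2) + (\<Sum>l\<in>?S. (x l)\<^sup>2)) / 2"
        by (simp only: sum.distrib sum_divide_distrib[symmetric])
      also have "\<dots> \<le> 1" using x y by simp
      finally have yx: "(\<Sum>l\<in>?S. y l * x l) \<le> 1" .
      have le_b: "L2_inner unit_cube (?U z i) (?U z i) \<le> b" if "(\<Sum>l\<in>?S. (z l)\<^sup>2) \<le> 1" for z i
        using U_bound[of z i] mult_left_mono[OF that b] by simp
      have "(\<Sum>i\<in>UNIV. \<Sum>j\<in>UNIV. P $ i $ j * L2_inner unit_cube (?U x i) (?U y j))
          \<le> (\<Sum>i\<in>UNIV. \<Sum>j\<in>UNIV. \<bar>P $ i $ j\<bar> * b)"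
      proof (intro sum_mono)
        \<comment> \<open>The directions may differ, so the block bound is not applied to this term
          directly but to the two pure terms, which dominate it.\<close>
        fix i j
        have "\<bar>L2_inner unit_cube (?U x i) (?U y j)\<bar> \<le> b"
          by (rule L2_inner_abs_le[OF U U le_b[OF x] le_b[OF y]])
        then have "\<bar>P $ i $ j * L2_inner unit_cube (?U x i) (?U y j)\<bar> \<le> \<bar>P $ i $ j\<bar> * b"
          unfolding abs_mult by (rule mult_left_mono) simp
        then show "P $ i $ j * L2_inner unit_cube (?U x i) (?U y j) \<le> \<bar>P $ i $ j\<bar> * b"
          by linarith
      qed
      also have "\<dots> = Q * b" by (simp only: Q_def sum_distrib_right)
      finally have stiffness: "(\<Sum>i\<in>UNIV. \<Sum>j\<in>UNIV. P $ i $ j * L2_inner unit_cube (?U x i) (?U y j)) \<le> Q * b" .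
      have "(1 / \<tau> + r / 2) * (\<Sum>l\<in>?S. y l * x l) \<le> (1 / \<tau> + r / 2) * 1"
        by (rule mult_left_mono[OF yx]) (use \<tau> assms(2) in simp)
      then have mass: "(1 / \<tau> + r / 2) * (\<Sum>l\<in>?S. y l * x l) \<le> 1 / \<tau> + r / 2"
        by (simp only: mult_1_right)
      show "(\<Sum>m\<in>?S. \<Sum>l\<in>?S. y m * ?M m l * x l) \<le> \<beta>"
        unfolding crank_nicolson_quadratic_form \<beta>_def
        by (rule add_mono[OF mass mult_left_mono[OF stiffness]]) simp
    qed
    also have "\<beta> / (1 / \<tau>) = 1 + \<tau> * (r / 2) + (\<tau> * 4 ^ k) * (1 / 2 * (Q * C2\<^sup>2))"
      using \<tau> by (simp add: \<beta>_def b_def field_simps)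
    also have "\<dots> \<le> 1 + \<gamma> / A * (r / 2) + \<gamma> / A * (1 / 2 * (Q * C2\<^sup>2))"
    proof -
      have "\<tau> * 4 ^ k \<le> \<gamma> / A" using \<tau> A by (simp add: field_simps)
      moreover have "\<tau> * 1 \<le> \<tau> * 4 ^ k" using \<tau> by (intro mult_left_mono) auto
      ultimately show ?thesis
        using Q assms(2) by (intro add_mono mult_right_mono) auto
    qed
    also have "\<dots> = C" by (simp add: C_def distrib_left)
    finally show ?thesis by simp
  qed
  then show ?thesis by blast
qed

end
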